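(* Let $\{p(x),\rho^x_C\}$ be an ensemble in which all $\rho^x_C$ are diagonal, let $\rho_{XC}=\sum_xp(x)|x\rangle\langle x|_X\otimes\rho^x_C$, let $n$ be a natural number and $\varepsilon\in(0,1)$. For any $(n,R,\varepsilon)$-entanglement-assisted blind distribution compression protocol (with either the global or the local error criterion), it holds that $$R\;\ge\;\min_{\mathcal{F}:C\to CC'}\big(\mathrm{I}(C:C'\,|\,X)_\tau\big)+\mathrm{I}(X:C)_\rho-\varepsilon\log|X|-1,$$ where $C'\equiv C$, $\tau_{XCC'}:=(\mathrm{id}_X\otimes\mathcal{F})(\rho_{XC})$, and the minimum is over completely positive trace preserving maps $\mathcal{F}$ from $C$ to $CC'$ that satisfy $\Delta(\tau_{XC'},\rho_{XC'})\le\varepsilon$ and $\tau_{XC}=\rho_{XC}$ (here $\rho_{XC'}$ is $\rho_{XC}$ with $C$ replaced by $C'$).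
   Context: All logarithms are base 2; Hilbert spaces are finite dimensional; $|A|$ is the dimension of register $A$; $A\equiv B$ means the registers have isomorphic Hilbert spaces; $\Delta(\rho,\sigma)=\frac12\|\rho-\sigma\|_1$. A missing register in a subscript denotes partial trace over it. With $\mathrm{S}$ the von Neumann entropy, $\mathrm{I}(A:B)_\rho=\mathrm{S}(A)_\rho+\mathrm{S}(B)_\rho-\mathrm{S}(AB)_\rho$ and $\mathrm{I}(A:B\,|\,C)_\rho=\mathrm{I}(A:BC)_\rho-\mathrm{I}(A:C)_\rho$. A map between registers means a completely positive trace preserving linear map. Entanglement-assisted blind distribution compression. A Referee and Alice share $\rho_{X_1C_1}\otimes\cdots\otimes\rho_{X_nC_n}$ ($n$ copies of $\rho_{XC}$), the Referee holding $X_1,\dots,X_n$ (each $X_i\equiv X$) and Alice holding $C_1,\dots,C_n$ (each $C_i\equiv C$). Alice and Bob share an arbitrary entangled state $|\theta\rangle_{E_AE_B}$ ($E_A$ with Alice, $E_B$ with Bob). In an $(n,R,\varepsilon)$-protocol Alice applies an encoding map $\mathcal{E}:C_1\cdots C_nE_A\to C_1\cdots C_nT$, where $T$ is a classical register of size $2^{nR}$ (so $nR=\log|T|$ bits are communicated), and sends $T$ to Bob, who applies a decoding map $\mathcal{D}:TE_B\to C'_1\cdots C'_n$ with each $C'_i\equiv C$. Since the ensemble is classical, one assumes without loss of generality that Alice retains a copy of her input, i.e. after the encoding and tracing out $T$ (and $E_B$) the state on $X_1C_1\cdots X_nC_n$ is still $\rho_{X_1C_1}\otimes\cdots\otimes\rho_{X_nC_n}$.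 Let $\omega$ be the final state of $X_1\cdots X_nC_1\cdots C_nC_1'\cdots C_n'$. Global error criterion: $\Delta(\omega_{X_1C_1'\cdots X_nC_n'},\rho_{X_1C_1'}\otimes\cdots\otimes\rho_{X_nC_n'})\le\varepsilon$. Local error criterion: for every $i$, $\Delta(\omega_{X_iC'_i},\rho_{X_iC'_i})\le\varepsilon$. *)

theory Defs
  imports "HOL-Analysis.Analysis"
begin

text \<open>
  A register is a finite type whose elements label the computational basis, and an operator on it is
  a complex square matrix indexed by that type. Joint registers are product types, and \<open>n\<close> copies of
  a register \<open>'a\<close> form the register \<open>'n \<Rightarrow> 'a\<close>, where \<open>'n\<close> is a finite type with \<open>CARD('n) = n\<close>.
\<close>

type_synonym 'a operator = "complex^'a^'a"

definition op_of :: "('a \<Rightarrow> 'a \<Rightarrow> complex) \<Rightarrow> ('a::finite) operator" where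
  "op_of f = (\<chi> i j. f i j)"

definition dagger :: "('a::finite) operator \<Rightarrow> 'a operator" where
  "dagger A = op_of (\<lambda>i j. cnj (A $ j $ i))"

definition unitary_op :: "('a::finite) operator \<Rightarrow> bool" where
  "unitary_op U \<longleftrightarrow> dagger U ** U = mat 1 \<and> U ** dagger U = mat 1"

definition real_diag :: "('a \<Rightarrow> real) \<Rightarrow> ('a::finite) operator" where
  "real_diag d = op_of (\<lambda>i j. if i = j then complex_of_real (d i) else 0)"

definition diagonal_op :: "('a::finite) operator \<Rightarrow> bool" where
  "diagonal_op A \<longleftrightarrow> (\<forall>i j. i \<noteq> j \<longrightarrow> A $ i $ j = 0)"


subsection \<open>States, entropies and the trace distance\<close>

definition psd :: "('a::finite) operator \<Rightarrow> bool" where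
  "psd A \<longleftrightarrow> (\<forall>v::complex^'a.
     let q = (\<Sum>i\<in>UNIV. \<Sum>j\<in>UNIV. cnj (v $ i) * A $ i $ j * v $ j) in q \<in> \<real> \<and> 0 \<le> Re q)"

definition density :: "('a::finite) operator \<Rightarrow> bool" where
  "density \<rho> \<longleftrightarrow> psd \<rho> \<and> trace \<rho> = 1"

text \<open>
  The function \<open>f\<close> of a Hermitian operator, by spectral calculus. By lemma \<open>herm_fun_eqI\<close> below, the
  result does not depend on the chosen diagonalization.
\<close>

definition herm_fun :: "(real \<Rightarrow> real) \<Rightarrow> ('a::finite) operator \<Rightarrow> 'a operator" where
  "herm_fun f A = (THE B. \<exists>U d. unitary_op U \<and> A = U ** real_diag d ** dagger U
                              \<and> B = U ** real_diag (f \<circ> d) ** dagger U)"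

lemma herm_fun_unique:
  fixes U V :: "('a::finite) operator"
  assumes U: "unitary_op U" and V: "unitary_op V"
    and eq: "U ** real_diag d ** dagger U = V ** real_diag e ** dagger V"
  shows "U ** real_diag (f \<circ> d) ** dagger U = V ** real_diag (f \<circ> e) ** dagger V"
proof -
  define W where "W = dagger V ** U"
  have UU: "dagger U ** U = mat 1" "U ** dagger U = mat 1"
    and VV: "dagger V ** V = mat 1" "V ** dagger V = mat 1"
    using U V by (auto simp: unitary_op_def)
  have right: "(M ** real_diag g) $ i $ j = M $ i $ j * complex_of_real (g j)"
    for M :: "'a operator" and g i j
    by (simp add: matrix_matrix_mult_def real_diag_def op_of_def if_distrib cong: if_cong)
  have left: "(real_diag g ** M) $ i $ j = complex_of_real (g i) * M $ i $ j"
    for M :: "'a operator" and g i j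
    by (simp add: matrix_matrix_mult_def real_diag_def op_of_def if_distrib if_distribR cong: if_cong)
  have "W ** real_diag d = dagger V ** (U ** real_diag d ** dagger U) ** U"
    by (simp add: W_def matrix_mul_assoc [symmetric] UU)
  also have "\<dots> = (dagger V ** V) ** real_diag e ** W"
    by (simp add: eq W_def matrix_mul_assoc)
  finally have "W ** real_diag d = real_diag e ** W"
    by (simp add: VV)
  then have entry: "W $ i $ j * complex_of_real (d j) = complex_of_real (e i) * W $ i $ j" for i j
    by (metis left right)
  have "W ** real_diag (f \<circ> d) = real_diag (f \<circ> e) ** W"
  proof -
    have "W $ i $ j * complex_of_real (f (d j)) = complex_of_real (f (e i)) * W $ i $ j" for i j
      using entry [of i j] by (cases "W $ i $ j = 0") auto
    then show ?thesis
      by (simp add: vec_eq_iff left right)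
  qed
  then have "V ** (W ** real_diag (f \<circ> d)) ** dagger U = V ** (real_diag (f \<circ> e) ** W) ** dagger U"
    by simp
  moreover have "V ** (W ** real_diag (f \<circ> d)) ** dagger U
      = (V ** dagger V) ** U ** real_diag (f \<circ> d) ** dagger U"
    by (simp add: W_def matrix_mul_assoc)
  moreover have "V ** (real_diag (f \<circ> e) ** W) ** dagger U
      = V ** real_diag (f \<circ> e) ** dagger V ** (U ** dagger U)"
    by (simp add: W_def matrix_mul_assoc)
  ultimately show ?thesis
    by (simp add: UU VV)
qed

lemma herm_fun_eqI:
  assumes "unitary_op U" and "A = U ** real_diag d ** dagger U"
  shows "herm_fun f A = U ** real_diag (f \<circ> d) ** dagger U"
  unfolding herm_fun_def
proof (rule the_equality)
  fix B
  assume "\<exists>V e. unitary_op V \<and> A = V ** real_diag e ** dagger V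
              \<and> B = V ** real_diag (f \<circ> e) ** dagger V"
  then show "B = U ** real_diag (f \<circ> d) ** dagger U"
    using assms herm_fun_unique by metis
qed (use assms in blast)

text \<open>Since \<open>log 2 0 = 0\<close> in HOL, the convention \<open>0 log 0 = 0\<close> holds automatically.\<close>

definition entropy_op :: "('a::finite) operator \<Rightarrow> real" where
  "entropy_op \<rho> = - Re (trace (\<rho> ** herm_fun (log 2) \<rho>))"

definition trace_norm :: "('a::finite) operator \<Rightarrow> real" where
  "trace_norm A = Re (trace (herm_fun sqrt (dagger A ** A)))"

definition trace_dist :: "('a::finite) operator \<Rightarrow> 'a operator \<Rightarrow> real" where
  "trace_dist \<rho> \<sigma> = trace_norm (\<rho> - \<sigma>) / 2"

definition ptrace_fst :: "('a::finite \<times> 'b::finite) operator \<Rightarrow> 'b operator" where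
  "ptrace_fst \<rho> = op_of (\<lambda>b b'. \<Sum>a\<in>UNIV. \<rho> $ (a, b) $ (a, b'))"

definition ptrace_snd :: "('a::finite \<times> 'b::finite) operator \<Rightarrow> 'a operator" where
  "ptrace_snd \<rho> = op_of (\<lambda>a a'. \<Sum>b\<in>UNIV. \<rho> $ (a, b) $ (a', b))"

text \<open>Regrouping of registers: \<open>g\<close> maps the labels of the new arrangement to those of the old one.\<close>

definition rearrange :: "('b \<Rightarrow> 'a) \<Rightarrow> ('a::finite) operator \<Rightarrow> ('b::finite) operator" where
  "rearrange g \<rho> = op_of (\<lambda>i j. \<rho> $ g i $ g j)"

definition mutual_info :: "('a::finite \<times> 'b::finite) operator \<Rightarrow> real" where
  "mutual_info \<rho> = entropy_op (ptrace_snd \<rho>) + entropy_op (ptrace_fst \<rho>) - entropy_op \<rho>"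

text \<open>For an operator on registers \<open>ABC\<close> in this order, this is \<open>I(A:B | C) = I(A:BC) - I(A:C)\<close>.\<close>

definition cond_mutual_info :: "('a::finite \<times> 'b::finite \<times> 'c::finite) operator \<Rightarrow> real" where
  "cond_mutual_info \<rho> =
     mutual_info \<rho> - mutual_info (ptrace_snd (rearrange (\<lambda>((a, c), b). (a, b, c)) \<rho>))"


subsection \<open>Maps between registers\<close>

text \<open>
  A \<open>k \<times> k\<close> array of operators is an operator on the joint system of a \<open>k\<close>-dimensional ancilla
  and the register; applying \<open>F\<close> to every block is \<open>id \<otimes> F\<close>. Complete positivity is thus positivity
  of \<open>id \<otimes> F\<close> for ancillas of every dimension \<open>k\<close>.
\<close>

definition block_psd :: "nat \<Rightarrow> (nat \<Rightarrow> nat \<Rightarrow> ('a::finite) operator) \<Rightarrow> bool" where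
  "block_psd k A \<longleftrightarrow> (\<forall>v :: nat \<Rightarrow> complex^'a.
     let q = (\<Sum>i<k. \<Sum>j<k. \<Sum>r\<in>UNIV. \<Sum>s\<in>UNIV. cnj (v i $ r) * A i j $ r $ s * v j $ s)
     in q \<in> \<real> \<and> 0 \<le> Re q)"

definition completely_positive :: "(('a::finite) operator \<Rightarrow> ('b::finite) operator) \<Rightarrow> bool" where
  "completely_positive F \<longleftrightarrow> (\<forall>k A. block_psd k A \<longrightarrow> block_psd k (\<lambda>i j. F (A i j)))"

definition cptp :: "(('a::finite) operator \<Rightarrow> ('b::finite) operator) \<Rightarrow> bool" where
  "cptp F \<longleftrightarrow>
     (\<forall>A B. F (A + B) = F A + F B) \<and>
     (\<forall>c A. F (map_matrix ((*) c) A) = map_matrix ((*) c) (F A)) \<and>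
     completely_positive F \<and>
     (\<forall>A. trace (F A) = trace A)"

definition id_tensor ::
  "(('a::finite) operator \<Rightarrow> ('b::finite) operator) \<Rightarrow> ('r::finite \<times> 'a) operator \<Rightarrow> ('r \<times> 'b) operator"
  where
  "id_tensor F \<rho> = op_of (\<lambda>(r, b) (r', b'). F (op_of (\<lambda>a a'. \<rho> $ (r, a) $ (r', a'))) $ b $ b')"

text \<open>The second output register is classical: every output is block diagonal with respect to it.\<close>

definition classical_snd :: "(('a::finite) operator \<Rightarrow> ('b::finite \<times> 't::finite) operator) \<Rightarrow> bool"
  where
  "classical_snd F \<longleftrightarrow> (\<forall>A b t b' t'. t \<noteq> t' \<longrightarrow> F A $ (b, t) $ (b', t') = 0)"


subsection \<open>Ensembles and compression protocols\<close>

definition ensemble :: "('x::finite \<Rightarrow> real) \<Rightarrow> ('x \<Rightarrow> ('c::finite) operator) \<Rightarrow> bool" where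
  "ensemble p \<rho> \<longleftrightarrow> (\<forall>x. 0 \<le> p x) \<and> (\<Sum>x\<in>UNIV. p x) = 1 \<and> (\<forall>x. density (\<rho> x))"

definition cq_state :: "('x::finite \<Rightarrow> real) \<Rightarrow> ('x \<Rightarrow> ('c::finite) operator) \<Rightarrow> ('x \<times> 'c) operator" where
  "cq_state p \<rho> =
     op_of (\<lambda>(x, c) (x', c'). if x = x' then complex_of_real (p x) * \<rho> x $ c $ c' else 0)"

definition copies ::
  "('x::finite \<times> 'c::finite) operator \<Rightarrow> (('n::finite \<Rightarrow> 'x) \<times> ('n \<Rightarrow> 'c)) operator" where
  "copies \<rho> = op_of (\<lambda>(xs, cs) (xs', cs'). \<Prod>i\<in>UNIV. \<rho> $ (xs i, cs i) $ (xs' i, cs' i))"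

definition copy_marginal ::
  "'n::finite \<Rightarrow> (('n \<Rightarrow> 'x::finite) \<times> ('n \<Rightarrow> 'c::finite)) operator \<Rightarrow> ('x \<times> 'c) operator" where
  "copy_marginal i \<sigma> = op_of (\<lambda>(x, c) (x', c').
     \<Sum>(xs, cs) | xs i = x \<and> cs i = c. \<sigma> $ (xs, cs) $ (xs(i := x'), cs(i := c')))"

text \<open>
  The initial state is \<open>\<rho>\<close> on \<open>X\<^sup>nC\<^sup>n\<close> tensor \<open>|\<theta>\<rangle>\<langle>\<theta>|\<close> on \<open>E\<^sub>AE\<^sub>B\<close>, arranged as \<open>(X\<^sup>n E\<^sub>B)(C\<^sup>n E\<^sub>A)\<close>
  so that Alice's registers come last. The encoded state is on \<open>(X\<^sup>n C\<^sup>n)(T E\<^sub>B)\<close>.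
\<close>

definition initial_state ::
  "('x::finite \<times> 'c::finite) operator \<Rightarrow> complex^('ea::finite \<times> 'eb::finite) \<Rightarrow>
   ((('n::finite \<Rightarrow> 'x) \<times> 'eb) \<times> (('n \<Rightarrow> 'c) \<times> 'ea)) operator" where
  "initial_state \<rho> \<theta> = op_of (\<lambda>((xs, b), (cs, a)) ((xs', b'), (cs', a')).
     copies \<rho> $ (xs, cs) $ (xs', cs') * (\<theta> $ (a, b) * cnj (\<theta> $ (a', b'))))"

definition encoded_state ::
  "('x::finite \<times> 'c::finite) operator \<Rightarrow> complex^('ea::finite \<times> 'eb::finite) \<Rightarrow>
   ((('n::finite \<Rightarrow> 'c) \<times> 'ea) operator \<Rightarrow> (('n \<Rightarrow> 'c) \<times> 't::finite) operator) \<Rightarrow>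
   ((('n \<Rightarrow> 'x) \<times> ('n \<Rightarrow> 'c)) \<times> ('t \<times> 'eb)) operator" where
  "encoded_state \<rho> \<theta> E =
     rearrange (\<lambda>((xs, cs), (t, b)). ((xs, b), (cs, t))) (id_tensor E (initial_state \<rho> \<theta>))"

definition final_state ::
  "('x::finite \<times> 'c::finite) operator \<Rightarrow> complex^('ea::finite \<times> 'eb::finite) \<Rightarrow>
   ((('n::finite \<Rightarrow> 'c) \<times> 'ea) operator \<Rightarrow> (('n \<Rightarrow> 'c) \<times> 't::finite) operator) \<Rightarrow>
   (('t \<times> 'eb) operator \<Rightarrow> ('n \<Rightarrow> 'c) operator) \<Rightarrow>
   ((('n \<Rightarrow> 'x) \<times> ('n \<Rightarrow> 'c)) \<times> ('n \<Rightarrow> 'c)) operator" where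
  "final_state \<rho> \<theta> E D = id_tensor D (encoded_state \<rho> \<theta> E)"

text \<open>The final state on \<open>X\<^sup>n C'\<^sup>n\<close>, with Alice's registers \<open>C\<^sup>n\<close> traced out.\<close>

definition output_state ::
  "('x::finite \<times> 'c::finite) operator \<Rightarrow> complex^('ea::finite \<times> 'eb::finite) \<Rightarrow>
   ((('n::finite \<Rightarrow> 'c) \<times> 'ea) operator \<Rightarrow> (('n \<Rightarrow> 'c) \<times> 't::finite) operator) \<Rightarrow>
   (('t \<times> 'eb) operator \<Rightarrow> ('n \<Rightarrow> 'c) operator) \<Rightarrow>
   (('n \<Rightarrow> 'x) \<times> ('n \<Rightarrow> 'c)) operator" where
  "output_state \<rho> \<theta> E D =
     ptrace_snd (rearrange (\<lambda>((xs, cs'), cs). ((xs, cs), cs')) (final_state \<rho> \<theta> E D))"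

text \<open>
  An entanglement-assisted blind protocol of rate \<open>R\<close> on \<open>n = CARD('n)\<close> copies, without error
  criterion. The last conjunct says that Alice retains a copy of her input.
\<close>

definition ea_blind_protocol ::
  "('x::finite \<times> 'c::finite) operator \<Rightarrow> real \<Rightarrow> complex^('ea::finite \<times> 'eb::finite) \<Rightarrow>
   ((('n::finite \<Rightarrow> 'c) \<times> 'ea) operator \<Rightarrow> (('n \<Rightarrow> 'c) \<times> 't::finite) operator) \<Rightarrow>
   (('t \<times> 'eb) operator \<Rightarrow> ('n \<Rightarrow> 'c) operator) \<Rightarrow> bool" where
  "ea_blind_protocol \<rho> R \<theta> E D \<longleftrightarrow>
     norm \<theta> = 1 \<and>
     cptp E \<and> classical_snd E \<and> cptp D \<and>
     real CARD('t) = 2 powr (real CARD('n) * R) \<and>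
     ptrace_snd (encoded_state \<rho> \<theta> E) = copies \<rho>"

definition global_error_le ::
  "('x::finite \<times> 'c::finite) operator \<Rightarrow> real \<Rightarrow> complex^('ea::finite \<times> 'eb::finite) \<Rightarrow>
   ((('n::finite \<Rightarrow> 'c) \<times> 'ea) operator \<Rightarrow> (('n \<Rightarrow> 'c) \<times> 't::finite) operator) \<Rightarrow>
   (('t \<times> 'eb) operator \<Rightarrow> ('n \<Rightarrow> 'c) operator) \<Rightarrow> bool" where
  "global_error_le \<rho> \<epsilon> \<theta> E D \<longleftrightarrow> trace_dist (output_state \<rho> \<theta> E D) (copies \<rho>) \<le> \<epsilon>"

definition local_error_le ::
  "('x::finite \<times> 'c::finite) operator \<Rightarrow> real \<Rightarrow> complex^('ea::finite \<times> 'eb::finite) \<Rightarrow>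
   ((('n::finite \<Rightarrow> 'c) \<times> 'ea) operator \<Rightarrow> (('n \<Rightarrow> 'c) \<times> 't::finite) operator) \<Rightarrow>
   (('t \<times> 'eb) operator \<Rightarrow> ('n \<Rightarrow> 'c) operator) \<Rightarrow> bool" where
  "local_error_le \<rho> \<epsilon> \<theta> E D \<longleftrightarrow>
     (\<forall>i. trace_dist (copy_marginal i (output_state \<rho> \<theta> E D)) \<rho> \<le> \<epsilon>)"


subsection \<open>The single-letter optimization\<close>

text \<open>For \<open>F\<close> from \<open>C\<close> to \<open>CC'\<close>, the state \<open>id_tensor F \<rho>\<close> is on \<open>XCC'\<close>.\<close>

definition feasible_map ::
  "('x::finite \<times> 'c::finite) operator \<Rightarrow> real \<Rightarrow> ('c operator \<Rightarrow> ('c \<times> 'c) operator) \<Rightarrow> bool" where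
  "feasible_map \<rho> \<epsilon> F \<longleftrightarrow>
     cptp F \<and>
     trace_dist (ptrace_snd (rearrange (\<lambda>((x, c'), c). (x, c, c')) (id_tensor F \<rho>))) \<rho> \<le> \<epsilon> \<and>
     ptrace_snd (rearrange (\<lambda>((x, c), c'). (x, c, c')) (id_tensor F \<rho>)) = \<rho>"

text \<open>The objective \<open>I(C:C' | X)\<close>.\<close>

definition map_cost ::
  "('x::finite \<times> 'c::finite) operator \<Rightarrow> ('c operator \<Rightarrow> ('c \<times> 'c) operator) \<Rightarrow> real" where
  "map_cost \<rho> F = cond_mutual_info (rearrange (\<lambda>(c, c', x). (x, c, c')) (id_tensor F \<rho>))"

end

theory Submission
  imports Defs
begin

text \<open>
  Since \<open>\<rho>\<close> is diagonal, the whole problem can be dephased. Measuring the output of the protocol in the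
  computational basis gives a classical channel \<open>K\<close> from \<open>C\<^sup>n\<close> to \<open>C'\<^sup>n\<close>, and the classical input
  itself serves as Alice's retained copy, so that the register \<open>C\<^sup>n\<close> returned by the encoder is irrelevant.
  As the message is classical and \<open>E\<^sub>B\<close> alone carries no information about the input, Bob's state is
  dominated by \<open>1\<^sub>T \<otimes> \<theta>\<^sub>B\<close>, an operator of trace \<open>|T|\<close> that does not depend on the input. Hence
  \<open>K(b|c) \<le> |T| Q(b)\<close> for a distribution \<open>Q\<close>, and Gibbs' inequality yields
  \<open>\<Sum>\<^sub>i I(X\<^sub>iC\<^sub>i : C'\<^sub>i) \<le> log |T| = nR\<close>. Each letter defines a feasible classical map, with
  \<open>I(X\<^sub>iC\<^sub>i : C'\<^sub>i) = I(X\<^sub>i : C'\<^sub>i) + I(C\<^sub>i : C'\<^sub>i | X\<^sub>i)\<close>, and \<open>I(X\<^sub>i : C'\<^sub>i)\<close> is within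
  \<open>\<epsilon> log |X| + 1\<close> of \<open>I(X : C)\<close> by continuity of the conditional entropy. The minimum is attained because
  the feasible maps form a compact set (Tychonoff) on which the cost is continuous; continuity of spectral
  functions follows from compactness of the unitary group.
\<close>

subsection \<open>Diagonalization of Hermitian operators\<close>

text \<open>The feasible set contains genuinely quantum maps, and the classical letter maps only
  have to lie above its minimum. Attaining that minimum forces the spectral apparatus: the entropies
  must be continuous at nondiagonal states, where eigenvectors cannot be chosen continuously. The
  loss per letter is an exact difference: I(C:C'|X) + I(X:C) - I(XC:C') equals H(X|C') - H(X|C), so
  a single continuity estimate yields both correction terms. The part of the output law exceeding
  the source law has mass at most \<open>\<epsilon>\<close> and costs at most log |X| per unit mass;
  recording whether a value belongs to the common part or to the excess costs at most one bit. The
  factor |T| instead of |T|^2 is due to block diagonality in T: each block of Bob's state is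
  dominated by the sum of all blocks, which no-signalling makes independent of the input. Testing
  the joint law against a product of letter posteriors replaces both the chain rule and the
  superadditivity of mutual information for independent inputs.\<close>

lemma op_of_nth [simp]: "op_of f $ i $ j = f i j"
  by (simp add: op_of_def)

lemma operator_eqI: "(\<And>i j. A $ i $ j = B $ i $ j) \<Longrightarrow> A = (B :: ('a::finite) operator)"
  by (simp add: vec_eq_iff)

lemma dagger_nth [simp]: "dagger A $ i $ j = cnj (A $ j $ i)"
  by (simp add: dagger_def)

lemma dagger_mult: "dagger (A ** B) = dagger B ** dagger A"
  by (rule operator_eqI) (simp add: matrix_matrix_mult_def mult.commute)

lemma dagger_dagger [simp]: "dagger (dagger A) = A"
  by (rule operator_eqI) simp

lemma real_diag_nth: "real_diag d $ i $ j = (if i = j then complex_of_real (d i) else 0)"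
  by (simp add: real_diag_def)

lemma unitary_opI: "dagger U ** U = mat 1 \<Longrightarrow> unitary_op U"
  by (simp add: unitary_op_def matrix_left_right_inverse)

lemma unitary_op_mult:
  assumes "unitary_op U" "unitary_op V"
  shows "unitary_op (U ** V)"
proof (rule unitary_opI)
  have "dagger (U ** V) ** (U ** V) = dagger V ** (dagger U ** U) ** V"
    by (simp only: dagger_mult matrix_mul_assoc)
  then show "dagger (U ** V) ** (U ** V) = mat 1" using assms by (simp add: unitary_op_def)
qed

lemma unitary_op_one: "unitary_op (mat 1 :: ('a::finite) operator)"
proof -
  have "dagger (mat 1 :: 'a operator) = mat 1" by (rule operator_eqI) (auto simp: mat_def)
  then show ?thesis by (intro unitary_opI) simp
qed

section \<open>Compactness of the unitary group\<close>

lemma continuous_on_operator_nth [continuous_intros]: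
  fixes f :: "'z::topological_space \<Rightarrow> ('a::finite) operator"
  shows "continuous_on S f \<Longrightarrow> continuous_on S (\<lambda>x. f x $ i $ j)"
  by (intro continuous_on_component)

lemma continuous_on_operatorI:
  fixes f :: "'z::topological_space \<Rightarrow> ('a::finite) operator"
  assumes "\<And>i j. continuous_on S (\<lambda>x. f x $ i $ j)"
  shows "continuous_on S f"
proof -
  have "continuous_on S (\<lambda>x. \<chi> i j. f x $ i $ j)"
    by (intro continuous_on_vec_lambda assms)
  then show ?thesis by simp
qed

lemma continuous_on_matmul [continuous_intros]:
  fixes f g :: "'z::topological_space \<Rightarrow> ('a::finite) operator"
  assumes "continuous_on S f" "continuous_on S g"
  shows "continuous_on S (\<lambda>x. f x ** g x)"
  by (rule continuous_on_operatorI) (auto simp: matrix_matrix_mult_def intro!: continuous_intros assms)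

lemma continuous_on_dagger [continuous_intros]:
  fixes f :: "'z::topological_space \<Rightarrow> ('a::finite) operator"
  assumes "continuous_on S f"
  shows "continuous_on S (\<lambda>x. dagger (f x))"
  by (rule continuous_on_operatorI) (auto intro!: continuous_intros assms)

lemma unitary_op_rows: "unitary_op U \<Longrightarrow> (\<Sum>j\<in>UNIV. (cmod (U $ i $ j))\<^sup>2) = 1"
proof -
  assume "unitary_op U"
  then have "(U ** dagger U) $ i $ i = 1" by (simp add: unitary_op_def mat_def)
  then have "(\<Sum>j\<in>UNIV. complex_of_real ((cmod (U $ i $ j))\<^sup>2)) = 1"
    by (simp add: matrix_matrix_mult_def flip: complex_norm_square)
  then show ?thesis by (metis of_real_sum of_real_eq_1_iff)
qed

lemma unitary_op_dagger: "unitary_op U \<Longrightarrow> unitary_op (dagger U)"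
  by (simp add: unitary_op_def)

lemma unitary_op_cols: "unitary_op U \<Longrightarrow> (\<Sum>i\<in>UNIV. (cmod (U $ i $ j))\<^sup>2) = 1"
  using unitary_op_rows[OF unitary_op_dagger, of U j] by simp

lemma bounded_operators:
  fixes S :: "('a::finite) operator set"
  assumes "\<And>A i j. A \<in> S \<Longrightarrow> cmod (A $ i $ j) \<le> M"
  shows "bounded S"
proof (rule boundedI)
  fix A assume A: "A \<in> S"
  have "norm A \<le> (\<Sum>i\<in>UNIV. norm (A $ i))" unfolding norm_vec_def by (rule L2_set_le_sum) simp
  also have "\<dots> \<le> (\<Sum>i\<in>UNIV. \<Sum>j\<in>UNIV. norm (A $ i $ j))"
    by (intro sum_mono) (subst norm_vec_def, rule L2_set_le_sum, simp)
  also have "\<dots> \<le> (\<Sum>i\<in>(UNIV::'a set). \<Sum>j\<in>(UNIV::'a set). M)"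
    by (intro sum_mono assms A)
  finally show "norm A \<le> (\<Sum>i\<in>(UNIV::'a set). \<Sum>j\<in>(UNIV::'a set). M)" .
qed

text \<open>Unit rows bound the entries by 1, and in finite dimension the single closed equation
  \<open>dagger U ** U = mat 1\<close> already defines unitarity.\<close>

lemma compact_unitary: "compact {U :: ('a::finite) operator. unitary_op U}"
  unfolding compact_eq_bounded_closed
proof
  have "cmod (U $ i $ j) \<le> 1" if "unitary_op U" for U :: "'a operator" and i j
  proof -
    have "(cmod (U $ i $ j))\<^sup>2 \<le> (\<Sum>j\<in>UNIV. (cmod (U $ i $ j))\<^sup>2)"
      by (rule member_le_sum) auto
    then show ?thesis using unitary_op_rows[OF that, of i] by (simp add: power2_le_imp_le)
  qed
  then show "bounded {U :: 'a operator. unitary_op U}"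
    by (intro bounded_operators) auto
  have "closed {U :: 'a operator. dagger U ** U = mat 1}"
    by (rule closed_Collect_eq) (rule continuous_intros | assumption)+
  moreover have "unitary_op U \<longleftrightarrow> dagger U ** U = mat 1" for U :: "'a operator"
    using unitary_op_def unitary_opI by blast
  ultimately show "closed {U :: 'a operator. unitary_op U}" by simp
qed

text \<open>A complex Jacobi rotation in the plane of \<open>p\<close> and \<open>q\<close>, with
  cosine \<open>c\<close>, sine \<open>s\<close> and phase \<open>\<alpha>\<close>; it is the
  identity elsewhere.\<close>

definition rot :: "'a \<Rightarrow> 'a \<Rightarrow> real \<Rightarrow> real \<Rightarrow> complex \<Rightarrow> ('a::finite) operator" where
  "rot p q c s \<alpha> = op_of (\<lambda>i j.
     if j = p then (if i = p then of_real c else if i = q then of_real s * \<alpha> else 0)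
     else if j = q then (if i = p then - of_real s * cnj \<alpha> else if i = q then of_real c else 0)
     else if i = j then 1 else 0)"

lemma rot_col:
  assumes "p \<noteq> q"
  shows "(\<Sum>k\<in>UNIV. rot p q c s \<alpha> $ k $ j * h k) =
    (if j = p then of_real c * h p + of_real s * \<alpha> * h q
     else if j = q then - of_real s * cnj \<alpha> * h p + of_real c * h q else h j)"
proof -
  have two: "(\<Sum>k\<in>UNIV. (if k = p then u else if k = q then v else 0) * h k) = u * h p + v * h q" for u v
  proof -
    have "(\<Sum>k\<in>UNIV. (if k = p then u else if k = q then v else 0) * h k)
      = (\<Sum>k\<in>UNIV. (if k = p then u * h k else 0) + (if k = q then v * h k else 0))"
      by (rule sum.cong) (use assms in auto)
    then show ?thesis by (simp add: sum.distrib)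
  qed
  show ?thesis
    using two[of "of_real c" "of_real s * \<alpha>"] two[of "- of_real s * cnj \<alpha>" "of_real c"]
    by (auto simp: rot_def if_distrib[of "\<lambda>x. x * _"] cong: if_cong)
qed

lemma rot_col_cnj:
  assumes "p \<noteq> q"
  shows "(\<Sum>k\<in>UNIV. cnj (rot p q c s \<alpha> $ k $ j) * h k) =
    (if j = p then of_real c * h p + of_real s * cnj \<alpha> * h q
     else if j = q then - of_real s * \<alpha> * h p + of_real c * h q else h j)"
  using arg_cong[OF rot_col[OF assms, of c s \<alpha> j "\<lambda>k. cnj (h k)"], of cnj]
  by (auto split: if_splits)

lemma unitary_rot:
  assumes "p \<noteq> q" "c\<^sup>2 + s\<^sup>2 = 1" "cmod \<alpha> = 1"
  shows "unitary_op (rot p q c s \<alpha>)"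
proof (rule unitary_opI, rule operator_eqI)
  fix i j
  have [simp]: "\<alpha> * cnj \<alpha> = 1" using complex_norm_square[of \<alpha>] assms(3) by simp
  have cs: "complex_of_real c * complex_of_real c + complex_of_real s * complex_of_real s = 1"
    using assms(2) by (metis of_real_1 of_real_add of_real_mult power2_eq_square)
  have 1: "of_real c * of_real c + of_real s * cnj \<alpha> * (of_real s * \<alpha>) = (1::complex)"
       "of_real s * \<alpha> * (of_real s * cnj \<alpha>) + of_real c * of_real c = (1::complex)"
    using cs \<open>\<alpha> * cnj \<alpha> = 1\<close> by algebra+
  show "(dagger (rot p q c s \<alpha>) ** rot p q c s \<alpha>) $ i $ j = mat 1 $ i $ j"
    unfolding matrix_matrix_mult_def dagger_nth vec_lambda_beta rot_col_cnj[OF assms(1)]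
    using assms(1) 1 by (auto simp: rot_def mat_def)
qed

lemma hermitian_nth: "dagger B = B \<Longrightarrow> cnj (B $ i $ j) = B $ j $ i"
  by (metis dagger_nth)

text \<open>Only the diagonal entries \<open>p\<close> and \<open>q\<close> change, and they
  exchange the same cross term with opposite signs. This is what lets a weighted diagonal sum detect
  the off-diagonal entry.\<close>

lemma rot_diag:
  assumes "p \<noteq> q" "dagger B = B"
  shows "Re ((dagger (rot p q c s \<alpha>) ** B ** rot p q c s \<alpha>) $ j $ j) =
    (if j = p then c\<^sup>2 * Re (B $ p $ p) + s\<^sup>2 * (cmod \<alpha>)\<^sup>2 * Re (B $ q $ q) + 2 * c * s * Re (\<alpha> * B $ p $ q)
     else if j = q then s\<^sup>2 * (cmod \<alpha>)\<^sup>2 * Re (B $ p $ p) + c\<^sup>2 * Re (B $ q $ q) - 2 * c * s * Re (\<alpha> * B $ p $ q)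
     else Re (B $ j $ j))"
proof -
  let ?G = "rot p q c s \<alpha>"
  have "(dagger ?G ** B ** ?G) $ j $ j = (\<Sum>k\<in>UNIV. cnj (?G $ k $ j) * (\<Sum>l\<in>UNIV. ?G $ l $ j * B $ k $ l))"
    unfolding matrix_mul_assoc[symmetric] by (simp add: matrix_matrix_mult_def mult.commute)
  also have "\<dots> = (if j = p then of_real c * (of_real c * B $ p $ p + of_real s * \<alpha> * B $ p $ q)
        + of_real s * cnj \<alpha> * (of_real c * B $ q $ p + of_real s * \<alpha> * B $ q $ q)
     else if j = q then - of_real s * \<alpha> * (- of_real s * cnj \<alpha> * B $ p $ p + of_real c * B $ p $ q)
        + of_real c * (- of_real s * cnj \<alpha> * B $ q $ p + of_real c * B $ q $ q) else B $ j $ j)"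
    unfolding rot_col_cnj[OF assms(1)] rot_col[OF assms(1)] using assms(1) by auto
  finally have *: "(dagger ?G ** B ** ?G) $ j $ j = \<dots>" .
  have qp: "B $ q $ p = cnj (B $ p $ q)" and im: "Im (B $ p $ p) = 0" "Im (B $ q $ q) = 0"
    using hermitian_nth[OF assms(2)] by (metis, (metis Reals_cnj_iff complex_is_Real_iff)+)
  \<comment> \<open>In real and imaginary parts both nontrivial cases become real polynomial
    identities.\<close>
  obtain x y where xy: "B $ p $ q = Complex x y" by (cases "B $ p $ q")
  obtain u v where uv: "\<alpha> = Complex u v" by (cases \<alpha>)
  consider "j = p" | "j = q" "j \<noteq> p" | "j \<noteq> p" "j \<noteq> q" by blast
  then show ?thesis
  proof cases
    case 1
    then show ?thesis unfolding * cmod_power2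
      by (simp add: qp im xy uv algebra_simps power2_eq_square)
  next
    case 2
    then show ?thesis unfolding * cmod_power2
      by (simp add: qp im xy uv algebra_simps power2_eq_square)
  next
    case 3
    then show ?thesis unfolding * by simp
  qed
qed

text \<open>Rotating by a small angle moves diagonal weight from \<open>q\<close> to
  \<open>p\<close> at first order in \<open>s\<close>, while the harm done by unequal diagonal
  entries is of order \<open>s\<^sup>2\<close>.\<close>

lemma rot_improves:
  fixes w :: "'a::finite \<Rightarrow> real" and B :: "'a operator"
  assumes "p \<noteq> q" "dagger B = B" "B $ p $ q \<noteq> 0" "w p > w q"
  obtains G where "unitary_op G"
    "(\<Sum>i\<in>UNIV. w i * Re (B $ i $ i)) < (\<Sum>i\<in>UNIV. w i * Re ((dagger G ** B ** G) $ i $ i))"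
proof -
  define b where "b = cmod (B $ p $ q)"
  define K where "K = \<bar>Re (B $ q $ q) - Re (B $ p $ p)\<bar>"
  have b: "b > 0" and K: "K \<ge> 0" using assms by (auto simp: b_def K_def)
  \<comment> \<open>This choice gives \<open>s * K < b\<close>, so the second-order loss is beaten,
    and \<open>s \<le> 1/2\<close>, so \<open>c > 1/2\<close> and the gain \<open>2 * c * b\<close>
    is at least \<open>b\<close>.\<close>
  define s where "s = b / (2 * b + K)"
  define c where "c = sqrt (1 - s\<^sup>2)"
  \<comment> \<open>The phase that turns the entry at \<open>p\<close>, \<open>q\<close> into the
    positive number \<open>b\<close>.\<close>
  define \<alpha> where "\<alpha> = cnj (B $ p $ q) / of_real b"
  have s: "0 < s" "s \<le> 1/2" using b K by (auto simp: s_def field_simps)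
  have s2: "s\<^sup>2 \<le> 1/4" using power_mono[OF s(2), of 2] s by (simp add: power2_eq_square)
  have c: "c > 1/2" unfolding c_def by (rule real_less_rsqrt) (use s2 in \<open>simp add: power2_eq_square\<close>)
  have cs: "c\<^sup>2 + s\<^sup>2 = 1" using s2 by (simp add: c_def)
  have a: "cmod \<alpha> = 1" using b by (simp add: \<alpha>_def b_def norm_divide)
  have "\<alpha> * B $ p $ q = of_real b"
    using b complex_norm_square[of "B $ p $ q"]
    by (simp add: \<alpha>_def b_def mult.commute power2_eq_square eq_divide_eq divide_eq_eq)
  then have ab: "Re (\<alpha> * B $ p $ q) = b" by simp
  let ?G = "rot p q c s \<alpha>"
  let ?d = "s\<^sup>2 * (Re (B $ q $ q) - Re (B $ p $ p)) + 2 * c * s * b"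
  have c2: "c\<^sup>2 = 1 - s\<^sup>2" using cs by simp
  have diff: "w i * Re ((dagger ?G ** B ** ?G) $ i $ i) - w i * Re (B $ i $ i) =
     (if i = p then w p * ?d else 0) + (if i = q then - w q * ?d else 0)" for i
    unfolding rot_diag[OF assms(1,2)] a ab c2 using assms(1)
    by (cases "i = p"; cases "i = q") (simp_all add: algebra_simps)
  have "(\<Sum>i\<in>UNIV. w i * Re ((dagger ?G ** B ** ?G) $ i $ i)) - (\<Sum>i\<in>UNIV. w i * Re (B $ i $ i))
      = (w p - w q) * ?d"
    unfolding sum_subtractf[symmetric] diff sum.distrib by (simp add: algebra_simps)
  moreover have "?d > 0"
  proof -
    have "s * K < b" using b K by (simp add: s_def field_simps)
    also have "b \<le> 2 * c * b" using c b by simp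
    finally have "s * (s * K) < s * (2 * c * b)" using s by simp
    moreover have "s\<^sup>2 * (Re (B $ q $ q) - Re (B $ p $ p)) \<ge> - (s * (s * K))"
    proof -
      have "s\<^sup>2 * (Re (B $ q $ q) - Re (B $ p $ p)) \<ge> s\<^sup>2 * (- K)"
        by (rule mult_left_mono) (auto simp: K_def)
      then show ?thesis by (simp add: power2_eq_square algebra_simps)
    qed
    ultimately show ?thesis by (simp add: algebra_simps)
  qed
  ultimately have "(\<Sum>i\<in>UNIV. w i * Re ((dagger ?G ** B ** ?G) $ i $ i)) > (\<Sum>i\<in>UNIV. w i * Re (B $ i $ i))"
    using mult_pos_pos[of "w p - w q" ?d] assms(4) by linarith
  then show thesis by (rule that[OF unitary_rot[OF assms(1) cs a]])
qed

text \<open>A unitary maximizing a weighted diagonal sum must diagonalize \<open>A\<close>: any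
  remaining off-diagonal entry would allow \<open>rot_improves\<close> to increase the sum.\<close>

lemma hermitian_diagonalization:
  fixes A :: "('a::finite) operator"
  assumes "dagger A = A"
  obtains U d where "unitary_op U" "A = U ** real_diag d ** dagger U"
proof -
  \<comment> \<open>The weights must be pairwise distinct; with constant weights \<open>f\<close>
    would be the trace, which every unitary leaves fixed.\<close>
  obtain w' :: "'a \<Rightarrow> nat" where "inj w'"
    using finite_imp_inj_to_nat_seg[of "UNIV :: 'a set"] by auto
  define w where "w = real \<circ> w'"
  have w: "w i \<noteq> w j" if "i \<noteq> j" for i j
    using that \<open>inj w'\<close> by (auto simp: w_def inj_def)
  define f where "f U = (\<Sum>i\<in>UNIV. w i * Re ((dagger U ** A ** U) $ i $ i))" for U
  have "continuous_on {U. unitary_op U} f"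
    unfolding f_def by (intro continuous_intros)
  moreover have "{U :: 'a operator. unitary_op U} \<noteq> {}" using unitary_op_one by auto
  ultimately obtain U where U: "unitary_op U" and max: "\<And>V. unitary_op V \<Longrightarrow> f V \<le> f U"
    using continuous_attains_sup[OF compact_unitary] by (metis mem_Collect_eq)
  define B where "B = dagger U ** A ** U"
  have herm: "dagger B = B" by (simp add: B_def dagger_mult assms matrix_mul_assoc)
  have no: "B $ p $ q = 0" if pq: "p \<noteq> q" "w p > w q" for p q
  proof (rule ccontr)
    assume "B $ p $ q \<noteq> 0"
    then obtain G where G: "unitary_op G"
      "(\<Sum>i\<in>UNIV. w i * Re (B $ i $ i)) < (\<Sum>i\<in>UNIV. w i * Re ((dagger G ** B ** G) $ i $ i))"
      using rot_improves[OF pq(1) herm _ pq(2)] by blast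
    then have "f U < f (U ** G)"
      by (simp add: f_def B_def dagger_mult matrix_mul_assoc)
    then show False using max[of "U ** G"] unitary_op_mult U G by fastforce
  qed
  have off: "B $ i $ j = 0" if "i \<noteq> j" for i j
  proof (cases "w i > w j")
    case False
    then have "B $ j $ i = 0" using no[of j i] w[OF that] that by auto
    then show ?thesis using hermitian_nth[OF herm, of j i] by simp
  qed (use no that in blast)
  have "B $ i $ i = of_real (Re (B $ i $ i))" for i
    using hermitian_nth[OF herm, of i i] by (metis Reals_cnj_iff of_real_Re)
  then have "B = real_diag (\<lambda>i. Re (B $ i $ i))"
    by (intro operator_eqI) (auto simp: real_diag_nth off)
  moreover have "A = U ** B ** dagger U"
  proof -
    have "U ** B ** dagger U = (U ** dagger U) ** A ** (U ** dagger U)"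
      by (simp add: B_def matrix_mul_assoc)
    then show ?thesis using U by (simp add: unitary_op_def)
  qed
  ultimately show thesis using that[OF U] by metis
qed

subsection \<open>Positive operators and continuity of spectral functions\<close>

definition qform :: "('a::finite) operator \<Rightarrow> complex^'a \<Rightarrow> complex" where
  "qform A v = (\<Sum>i\<in>UNIV. \<Sum>j\<in>UNIV. cnj (v $ i) * A $ i $ j * v $ j)"

lemma psd_iff: "psd A \<longleftrightarrow> (\<forall>v. qform A v \<in> \<real>\<^sub>\<ge>\<^sub>0)"
  by (simp add: psd_def qform_def Let_def complex_nonneg_Reals_iff complex_is_Real_iff conj_commute)

lemma nonneg_Reals_sum: "(\<And>i. i \<in> S \<Longrightarrow> f i \<in> \<real>\<^sub>\<ge>\<^sub>0) \<Longrightarrow> sum f S \<in> (\<real>\<^sub>\<ge>\<^sub>0 :: complex set)"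
  by (induction S rule: infinite_finite_induct) (auto intro: nonneg_Reals_add_I)

lemma nonneg_Reals_cnj_mult: "cnj z * z \<in> \<real>\<^sub>\<ge>\<^sub>0"
  by (metis complex_norm_square mult.commute nonneg_Reals_of_real_iff zero_le_power2)

text \<open>Vectors supported on at most two basis states suffice to read off single entries;
  \<open>i = j\<close> is allowed and gives the diagonal ones.\<close>

lemma qform_two:
  "qform A (\<chi> k. (if k = i then u else 0) + (if k = j then w else 0)) =
    cnj u * A $ i $ i * u + cnj u * A $ i $ j * w + cnj w * A $ j $ i * u + cnj w * A $ j $ j * w"
proof -
  have *: "(\<Sum>k\<in>UNIV. h k * ((if k = i then u else 0) + (if k = j then w else 0))) = h i * u + h j * w" for h
  proof -
    have "(\<Sum>k\<in>UNIV. h k * ((if k = i then u else 0) + (if k = j then w else 0))) =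
      (\<Sum>k\<in>UNIV. (if k = i then h k * u else 0) + (if k = j then h k * w else 0))"
      by (rule sum.cong) (auto simp: algebra_simps)
    then show ?thesis by (simp add: sum.distrib)
  qed
  have **: "(\<Sum>k\<in>UNIV. cnj ((if k = i then u else 0) + (if k = j then w else 0)) * h k) = cnj u * h i + cnj w * h j" for h
    using arg_cong[OF *[of "\<lambda>k. cnj (h k)"], of cnj] by (simp add: mult.commute)
  have "qform A (\<chi> k. (if k = i then u else 0) + (if k = j then w else 0)) =
    (\<Sum>k\<in>UNIV. cnj ((if k = i then u else 0) + (if k = j then w else 0)) *
      (\<Sum>l\<in>UNIV. A $ k $ l * ((if l = i then u else 0) + (if l = j then w else 0))))"
    by (simp only: qform_def vec_lambda_beta sum_distrib_left mult.assoc)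
  also have "\<dots> = cnj u * A $ i $ i * u + cnj u * A $ i $ j * w + cnj w * A $ j $ i * u + cnj w * A $ j $ j * w"
    unfolding * ** by (simp add: algebra_simps)
  finally show ?thesis .
qed

lemma psd_diag: assumes "psd A" shows "A $ i $ i \<in> \<real>\<^sub>\<ge>\<^sub>0"
  using assms[unfolded psd_iff, rule_format, of "\<chi> k. (if k = i then 1 else 0) + (if k = i then 0 else 0)"]
  unfolding qform_two by simp

text \<open>Realness of the form at \<open>e_i + e_j\<close> makes the imaginary parts of the two
  entries opposite, and realness at \<open>e_i + \<i> e_j\<close> makes the real parts
  equal.\<close>

lemma psd_hermitian:
  assumes "psd A"
  shows "dagger A = A"
proof (rule operator_eqI)
  fix i j
  have d: "Im (A $ k $ k) = 0" for k
    using psd_diag[OF assms, of k] by (simp add: complex_nonneg_Reals_iff)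
  have "Im (A $ i $ j) + Im (A $ j $ i) = 0"
    using assms[unfolded psd_iff, rule_format, of "\<chi> k. (if k = i then 1 else 0) + (if k = j then 1 else 0)"]
    unfolding qform_two by (simp add: complex_nonneg_Reals_iff d)
  moreover have "Re (A $ i $ j) - Re (A $ j $ i) = 0"
    using assms[unfolded psd_iff, rule_format, of "\<chi> k. (if k = i then 1 else 0) + (if k = j then \<i> else 0)"]
    unfolding qform_two by (simp add: complex_nonneg_Reals_iff d)
  ultimately show "dagger A $ i $ j = A $ i $ j"
    by (simp add: complex_eq_iff)
qed

lemma diag_mult_nth: "(M ** real_diag g) $ i $ j = M $ i $ j * complex_of_real (g j)"
  by (simp add: matrix_matrix_mult_def real_diag_nth if_distrib cong: if_cong)

lemma spectral_nth:
  "(U ** real_diag d ** dagger U) $ i $ j = (\<Sum>k\<in>UNIV. U $ i $ k * of_real (d k) * cnj (U $ j $ k))"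
  by (subst matrix_matrix_mult_def) (simp add: diag_mult_nth)

lemma trace_spectral:
  assumes "unitary_op U"
  shows "trace (U ** real_diag d ** dagger U) = of_real (\<Sum>k\<in>UNIV. d k)"
proof -
  have "trace (U ** real_diag d ** dagger U) = trace (dagger U ** (U ** real_diag d))"
    by (rule trace_mul_sym)
  also have "dagger U ** (U ** real_diag d) = real_diag d"
    using assms by (simp add: matrix_mul_assoc unitary_op_def)
  finally show ?thesis by (simp add: trace_def real_diag_nth)
qed

text \<open>Each eigenvalue is the quadratic form at a column of \<open>U\<close>. Together with the
  trace this confines the spectrum to the interval from 0 to the trace.\<close>

lemma psd_diagonalization:
  assumes "psd A"
  obtains U d where "unitary_op U" "A = U ** real_diag d ** dagger U" "\<And>k. 0 \<le> d k"
    "(\<Sum>k\<in>UNIV. d k) = Re (trace A)"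
proof -
  obtain U d where U: "unitary_op U" and A: "A = U ** real_diag d ** dagger U"
    using hermitian_diagonalization[OF psd_hermitian[OF assms]] .
  have "dagger U ** A ** U = (dagger U ** U) ** real_diag d ** (dagger U ** U)"
    by (simp add: A matrix_mul_assoc)
  then have D: "dagger U ** A ** U = real_diag d" using U by (simp add: unitary_op_def)
  have "0 \<le> d k" for k
  proof -
    have "of_real (d k) = (dagger U ** (A ** U)) $ k $ k" using D by (simp add: real_diag_nth matrix_mul_assoc)
    also have "\<dots> = qform A (\<chi> i. U $ i $ k)"
      by (simp add: matrix_matrix_mult_def qform_def sum_distrib_left mult.assoc)
    finally show ?thesis using assms unfolding psd_iff
      by (metis nonneg_Reals_of_real_iff)
  qed
  then show thesis using that[OF U A] trace_spectral[OF U, of d] A by simp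
qed

text \<open>In the spectral decomposition each rank-one term has entries no larger than its
  eigenvalue. As channels preserve the trace, this later bounds all of them uniformly.\<close>

lemma psd_nth_le_trace:
  assumes "psd A"
  shows "cmod (A $ i $ j) \<le> Re (trace A)"
proof -
  obtain U d where U: "unitary_op U" and A: "A = U ** real_diag d ** dagger U" and d: "\<And>k. 0 \<le> d k"
    "(\<Sum>k\<in>UNIV. d k) = Re (trace A)" using psd_diagonalization[OF assms] by blast
  have U1: "cmod (U $ i $ k) \<le> 1" for i k
  proof -
    have "(cmod (U $ i $ k))\<^sup>2 \<le> (\<Sum>j\<in>UNIV. (cmod (U $ i $ j))\<^sup>2)"
      by (rule member_le_sum) auto
    then show ?thesis using unitary_op_rows[OF U, of i] by (simp add: power2_le_imp_le)
  qed
  have "cmod (A $ i $ j) \<le> (\<Sum>k\<in>UNIV. cmod (U $ i $ k * of_real (d k) * cnj (U $ j $ k)))"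
    unfolding A spectral_nth by (rule norm_sum)
  also have "\<dots> \<le> (\<Sum>k\<in>UNIV. d k)"
  proof (rule sum_mono)
    fix k
    have "cmod (U $ i $ k) * d k * cmod (U $ j $ k) \<le> 1 * d k * 1"
      using U1 d(1) by (intro mult_mono mult_nonneg_nonneg) auto
    then show "cmod (U $ i $ k * of_real (d k) * cnj (U $ j $ k)) \<le> d k"
      using d(1)[of k] by (simp add: norm_mult)
  qed
  finally show ?thesis using d(2) by simp
qed

lemma trace_herm_fun:
  assumes "unitary_op U"
  shows "Re (trace (herm_fun f (U ** real_diag d ** dagger U))) = (\<Sum>k\<in>UNIV. f (d k))"
  using trace_spectral[OF assms, of "f \<circ> d"] by (simp add: herm_fun_eqI[OF assms refl])

lemma entropy_op_spectral:
  assumes "unitary_op U"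
  shows "entropy_op (U ** real_diag d ** dagger U) = - (\<Sum>k\<in>UNIV. d k * log 2 (d k))"
proof -
  have "real_diag d ** real_diag (log 2 \<circ> d) = real_diag (\<lambda>k. d k * log 2 (d k))"
    by (rule operator_eqI) (simp add: diag_mult_nth, simp add: real_diag_nth)
  moreover have "(U ** real_diag d ** dagger U) ** (U ** real_diag (log 2 \<circ> d) ** dagger U)
     = U ** real_diag d ** (dagger U ** U) ** real_diag (log 2 \<circ> d) ** dagger U"
    by (simp add: matrix_mul_assoc)
  moreover have "dagger U ** U = mat 1" using assms by (simp add: unitary_op_def)
  ultimately have "(U ** real_diag d ** dagger U) ** (U ** real_diag (log 2 \<circ> d) ** dagger U)
     = U ** real_diag (\<lambda>k. d k * log 2 (d k)) ** dagger U"
    by (simp only: matrix_mul_assoc[symmetric]) (simp add: matrix_mul_assoc)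
  then show ?thesis
    unfolding entropy_op_def herm_fun_eqI[OF assms refl] by (simp add: trace_spectral[OF assms])
qed

lemma real_diag_spectral: "real_diag d = mat 1 ** real_diag d ** dagger (mat 1)"
proof -
  have "dagger (mat 1 :: 'a operator) = mat 1" by (rule operator_eqI) (auto simp: mat_def)
  then show ?thesis by simp
qed

lemma entropy_op_real_diag: "entropy_op (real_diag d) = - (\<Sum>k\<in>UNIV. d k * log 2 (d k))"
  using entropy_op_spectral[OF unitary_op_one, of d] real_diag_spectral[of d] by simp

lemma trace_norm_real_diag: "trace_norm (real_diag d) = (\<Sum>k\<in>UNIV. \<bar>d k\<bar>)"
proof -
  have "dagger (real_diag d) ** real_diag d = real_diag (\<lambda>k. d k * d k)"
    by (rule operator_eqI) (simp add: diag_mult_nth, simp add: real_diag_nth)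
  then show ?thesis unfolding trace_norm_def
    using trace_herm_fun[OF unitary_op_one, of sqrt "\<lambda>k. d k * d k"]
      real_diag_spectral[of "\<lambda>k. d k * d k"] by simp
qed

lemma qform_dagger_mult: "qform (dagger A ** A) v = (\<Sum>k\<in>UNIV. cnj ((A *v v) $ k) * (A *v v) $ k)"
proof -
  have "qform (dagger A ** A) v = (\<Sum>i\<in>UNIV. \<Sum>j\<in>UNIV. \<Sum>k\<in>UNIV. cnj (v $ i) * (cnj (A $ k $ i) * A $ k $ j) * v $ j)"
    by (simp add: qform_def matrix_matrix_mult_def sum_distrib_left sum_distrib_right)
  also have "\<dots> = (\<Sum>i\<in>UNIV. \<Sum>k\<in>UNIV. \<Sum>j\<in>UNIV. cnj (v $ i) * (cnj (A $ k $ i) * A $ k $ j) * v $ j)"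
    by (intro sum.cong refl sum.swap)
  also have "\<dots> = (\<Sum>k\<in>UNIV. \<Sum>i\<in>UNIV. \<Sum>j\<in>UNIV. cnj (v $ i) * (cnj (A $ k $ i) * A $ k $ j) * v $ j)"
    by (rule sum.swap)
  also have "\<dots> = (\<Sum>k\<in>UNIV. cnj ((A *v v) $ k) * (A *v v) $ k)"
    by (simp add: matrix_vector_mult_def sum_product mult.commute mult.left_commute mult.assoc)
       (rule sum.cong[OF refl], rule sum.swap)
  finally show ?thesis .
qed

lemma psd_dagger_mult: "psd (dagger A ** A)"
  unfolding psd_iff qform_dagger_mult by (intro allI nonneg_Reals_sum nonneg_Reals_cnj_mult)

text \<open>With \<open>A\<^sup>\<dagger>A = V S\<^sup>2 V\<^sup>\<dagger>\<close>, the columns of \<open>AV\<close> have the singular values as norms and \<open>A = (AV)V\<^sup>\<dagger>\<close>.\<close>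

lemma sum_cmod_diag_le_trace_norm:
  fixes A :: "('a::finite) operator"
  shows "(\<Sum>i\<in>UNIV. cmod (A $ i $ i)) \<le> trace_norm A"
proof -
  obtain V d where V: "unitary_op V" and AA: "dagger A ** A = V ** real_diag d ** dagger V"
    and d: "\<And>k. 0 \<le> d k"
    using psd_diagonalization[OF psd_dagger_mult[of A]] by metis
  define W where "W = A ** V"
  have "dagger W ** W = dagger V ** (dagger A ** A) ** V"
    by (simp add: W_def dagger_mult matrix_mul_assoc)
  also have "\<dots> = (dagger V ** V) ** real_diag d ** (dagger V ** V)"
    by (simp add: AA matrix_mul_assoc)
  finally have WW: "dagger W ** W = real_diag d" using V by (simp add: unitary_op_def)
  have Wc: "(\<Sum>i\<in>UNIV. (cmod (W $ i $ k))\<^sup>2) = d k" for k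
  proof -
    have "of_real (d k) = (dagger W ** W) $ k $ k" by (simp add: WW real_diag_nth)
    also have "\<dots> = of_real (\<Sum>i\<in>UNIV. (cmod (W $ i $ k))\<^sup>2)"
      by (simp add: matrix_matrix_mult_def complex_norm_square mult.commute del: of_real_power)
    finally show ?thesis by (metis of_real_eq_iff)
  qed
  have "A = W ** dagger V"
    using V by (simp add: W_def matrix_mul_assoc[symmetric] unitary_op_def)
  then have Ad: "A $ i $ i = (\<Sum>k\<in>UNIV. W $ i $ k * cnj (V $ i $ k))" for i
    by (simp add: matrix_matrix_mult_def)
  have "(\<Sum>i\<in>UNIV. cmod (A $ i $ i)) \<le> (\<Sum>i\<in>UNIV. \<Sum>k\<in>UNIV. cmod (W $ i $ k) * cmod (V $ i $ k))"
    unfolding Ad by (intro sum_mono order_trans[OF norm_sum]) (simp add: norm_mult)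
  also have "\<dots> = (\<Sum>k\<in>UNIV. \<Sum>i\<in>UNIV. cmod (W $ i $ k) * cmod (V $ i $ k))"
    by (rule sum.swap)
  also have "\<dots> \<le> (\<Sum>k\<in>UNIV. sqrt (d k))"
  proof (rule sum_mono)
    fix k
    \<comment> \<open>Cauchy-Schwarz on column \<open>k\<close>: its squared norm is
      \<open>d k\<close> in \<open>W\<close> and 1 in \<open>V\<close>.\<close>
    have "(\<Sum>i\<in>UNIV. \<bar>cmod (W $ i $ k)\<bar> * \<bar>cmod (V $ i $ k)\<bar>) \<le>
       L2_set (\<lambda>i. cmod (W $ i $ k)) UNIV * L2_set (\<lambda>i. cmod (V $ i $ k)) UNIV"
      by (rule L2_set_mult_ineq)
    then show "(\<Sum>i\<in>UNIV. cmod (W $ i $ k) * cmod (V $ i $ k)) \<le> sqrt (d k)"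
      by (simp add: L2_set_def Wc unitary_op_cols[OF V])
  qed
  also have "\<dots> = trace_norm A"
    unfolding trace_norm_def AA by (simp add: trace_herm_fun[OF V])
  finally show ?thesis .
qed

text \<open>A continuous map from a compact space to a Hausdorff space is closed, hence a quotient
  map onto its image, so continuity of \<open>g\<close> may be tested after composing with
  \<open>\<phi>\<close>.\<close>

lemma continuous_on_compact_image:
  fixes \<phi> :: "'z::topological_space \<Rightarrow> 'y::t2_space" and g :: "'y \<Rightarrow> 'w::topological_space"
  assumes K: "compact K" and phi: "continuous_on K \<phi>" and g: "continuous_on K (\<lambda>z. g (\<phi> z))"
  shows "continuous_on (\<phi> ` K) g"
  unfolding continuous_on_closed_invariant
proof (intro allI impI)
  fix B :: "'w set" assume "closed B"
  then obtain C where C: "closed C" "C \<inter> K = (\<lambda>z. g (\<phi> z)) -` B \<inter> K"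
    using g unfolding continuous_on_closed_invariant by blast
  have "compact (C \<inter> K)" using K C(1) by (simp add: closed_Int_compact)
  then have "compact (\<phi> ` (C \<inter> K))"
    by (rule compact_continuous_image[rotated]) (rule continuous_on_subset[OF phi], simp)
  then have "closed (\<phi> ` (C \<inter> K))" by (rule compact_imp_closed)
  moreover have "\<phi> ` (C \<inter> K) \<inter> \<phi> ` K = g -` B \<inter> \<phi> ` K"
    using C(2) by auto
  ultimately show "\<exists>A. closed A \<and> A \<inter> \<phi> ` K = g -` B \<inter> \<phi> ` K" by blast
qed

text \<open>Operators are parametrized by pairs of a unitary and a spectrum. The parameter set is
  compact and the spectral sum is visibly continuous on it, so no continuous choice of eigenvectors
  is required. The bound \<open>M\<close> on the trace bounds the eigenvalues.\<close>

lemma continuous_on_spectral_sum: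
  fixes g :: "('a::finite) operator \<Rightarrow> real"
  assumes f: "continuous_on {0..M} f"
    and g: "\<And>U d. unitary_op U \<Longrightarrow> g (U ** real_diag d ** dagger U) = (\<Sum>k\<in>UNIV. f (d k))"
  shows "continuous_on {A. psd A \<and> Re (trace A) \<le> M} g"
proof -
  define K where "K = {U :: 'a operator. unitary_op U} \<times> cbox (0 :: real^'a) (\<chi> k. M)"
  define \<phi> where "\<phi> = (\<lambda>(U :: 'a operator, x :: real^'a). U ** real_diag (\<lambda>k. x $ k) ** dagger U)"
  have K: "compact K" unfolding K_def by (intro compact_Times compact_unitary compact_cbox)
  have "continuous_on K (\<lambda>z. real_diag (\<lambda>k. snd z $ k) :: 'a operator)"
  proof (rule continuous_on_operatorI)
    fix i j
    show "continuous_on K (\<lambda>z. (real_diag (\<lambda>k. snd z $ k) :: 'a operator) $ i $ j)"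
      by (cases "i = j") (simp_all add: real_diag_nth continuous_intros)
  qed
  then have phi: "continuous_on K \<phi>"
    unfolding \<phi>_def case_prod_beta by (intro continuous_intros)
  have "continuous_on K (\<lambda>z. \<Sum>k\<in>UNIV. f (snd z $ k))"
    by (intro continuous_intros continuous_on_compose2[OF f])
       (auto simp: K_def mem_box_cart)
  moreover have "g (\<phi> z) = (\<Sum>k\<in>UNIV. f (snd z $ k))" if "z \<in> K" for z
    using that g by (auto simp: K_def \<phi>_def)
  ultimately have "continuous_on K (\<lambda>z. g (\<phi> z))" by (simp cong: continuous_on_cong)
  from continuous_on_compact_image[OF K phi this]
  show ?thesis
  proof (rule continuous_on_subset, safe)
    fix A :: "'a operator" assume A: "psd A" "Re (trace A) \<le> M"
    obtain U d where U: "unitary_op U" "A = U ** real_diag d ** dagger U" "\<And>k. 0 \<le> d k"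
      "(\<Sum>k\<in>UNIV. d k) = Re (trace A)" using psd_diagonalization[OF A(1)] by blast
    have "d k \<le> M" for k
      using member_le_sum[of k UNIV d] U(3,4) A(2) by auto
    then have "(U, \<chi> k. d k) \<in> K" using U by (auto simp: K_def mem_box_cart)
    moreover have "\<phi> (U, \<chi> k. d k) = A" unfolding U(2) \<phi>_def by (simp add: vec_lambda_inverse)
    ultimately show "A \<in> \<phi> ` K" by blast
  qed
qed

lemma continuous_on_x_log_x: "continuous_on {0..M} (\<lambda>x::real. x * log 2 x)"
proof (unfold continuous_on_eq_continuous_within, intro ballI)
  fix x :: real assume x: "x \<in> {0..M}"
  show "continuous (at x within {0..M}) (\<lambda>x. x * log 2 x)"
  proof (cases "x = 0")
    case False
    then show ?thesis using x by (intro continuous_intros) auto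
  next
    case True
    \<comment> \<open>From \<open>ln t \<le> t\<close> at \<open>t = 1 / sqrt y\<close>. It squeezes
      the function to 0, which is also its value at 0 because \<open>log 2 0 = 0\<close>.\<close>
    have bound: "\<bar>y * log 2 y\<bar> \<le> 2 * sqrt y / ln 2" if "y \<in> {0..1}" for y :: real
    proof (cases "y = 0")
      case False
      then have y: "0 < y" "y \<le> 1" using that by auto
      have "ln (1 / sqrt y) \<le> 1 / sqrt y" using y by (intro ln_bound) auto
      then have "- ln y \<le> 2 * (1 / sqrt y)" using y by (simp add: ln_div ln_sqrt)
      then have "y * - ln y \<le> y * (2 * (1 / sqrt y))" using y by (intro mult_left_mono) auto
      also have "\<dots> = 2 * sqrt y" using y by (simp add: field_simps)
      finally have "\<bar>y * ln y\<bar> \<le> 2 * sqrt y" using y by (simp add: abs_mult)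
      then show ?thesis by (simp add: log_def abs_mult divide_right_mono flip: abs_mult)
    qed simp
    have "((\<lambda>y. y * log 2 y) \<longlongrightarrow> 0) (at 0 within {0..M})"
    proof (rule Lim_null_comparison)
      have "\<forall>\<^sub>F y in at (0::real). y < 1"
        by (rule order_tendstoD[OF tendsto_ident_at]) simp
      then have "\<forall>\<^sub>F y in at (0::real) within {0..M}. y < 1"
        by (rule filter_leD[OF at_le, rotated]) simp
      moreover have "\<forall>\<^sub>F y in at (0::real) within {0..M}. y \<in> {0..M}"
        by (simp add: eventually_at_filter)
      ultimately show "\<forall>\<^sub>F y in at 0 within {0..M}. norm (y * log 2 y) \<le> 2 * sqrt y / ln 2"
        by eventually_elim (use bound in auto)
      have "((\<lambda>y. 2 * sqrt y / ln 2) \<longlongrightarrow> 2 * sqrt 0 / ln 2) (at (0::real) within {0..M})"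
        by (intro tendsto_intros) simp
      then show "((\<lambda>y. 2 * sqrt y / ln 2) \<longlongrightarrow> 0) (at (0::real) within {0..M})" by simp
    qed
    then show ?thesis by (simp add: True continuous_within)
  qed
qed

lemma continuous_on_entropy_op: "continuous_on {A. density A} entropy_op"
proof -
  have "continuous_on {0..1} (\<lambda>x::real. - (x * log 2 x))"
    by (intro continuous_intros continuous_on_x_log_x)
  then have "continuous_on {A :: 'a operator. psd A \<and> Re (trace A) \<le> 1} entropy_op"
    by (rule continuous_on_spectral_sum) (simp add: entropy_op_spectral sum_negf)
  then show ?thesis
    by (rule continuous_on_subset) (auto simp: density_def)
qed

text \<open>The spectral lemma needs a bound on the trace of \<open>dagger B ** B\<close>, so the
  argument is local: on the open set \<open>S\<close> around \<open>A\<close> that trace stays below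
  \<open>q A + 1\<close>.\<close>

lemma continuous_on_trace_norm: "continuous_on UNIV (trace_norm :: ('a::finite) operator \<Rightarrow> real)"
proof (intro continuous_at_imp_continuous_on ballI)
  fix A :: "'a operator"
  define q where "q B = Re (trace (dagger B ** B))" for B :: "'a operator"
  define S where "S = {B. q B < q A + 1}"
  have "continuous_on UNIV q"
    unfolding q_def trace_def by (intro continuous_intros)
  then have "open S" unfolding S_def by (intro open_Collect_less continuous_intros)
  have "continuous_on {B :: 'a operator. psd B \<and> Re (trace B) \<le> q A + 1} (\<lambda>B. Re (trace (herm_fun sqrt B)))"
    by (rule continuous_on_spectral_sum[OF continuous_on_real_sqrt[OF continuous_on_id]])
       (rule trace_herm_fun)
  then have "continuous_on S trace_norm"
    unfolding trace_norm_def
    by (rule continuous_on_compose2) (auto simp: S_def q_def psd_dagger_mult intro!: continuous_intros)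
  then show "isCont trace_norm A"
    using \<open>open S\<close> by (simp add: continuous_on_eq_continuous_at S_def)
qed

subsection \<open>Compactness of the feasible maps\<close>

lemma sum_UNIV_prod:
  "(\<Sum>k\<in>(UNIV :: ('a::finite \<times> 'b::finite) set). f k) = (\<Sum>a\<in>UNIV. \<Sum>b\<in>UNIV. f (a, b))"
  by (simp add: sum.cartesian_product)

lemma sum_if_const: "(\<Sum>x\<in>S. if P then f x else 0) = (if P then sum f S else (0 :: complex))"
  by simp

lemma psd_rearrange:
  assumes g: "bij g" and A: "psd A"
  shows "psd (rearrange g A)"
  unfolding psd_iff
proof
  fix v
  have r: "(\<Sum>i\<in>UNIV. h (g i)) = (\<Sum>i\<in>UNIV. h i)" for h :: "_ \<Rightarrow> complex"
    by (rule sum.reindex_bij_betw[OF g])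
  have "qform A (\<chi> k. v $ inv g k) =
      (\<Sum>i\<in>UNIV. \<Sum>j\<in>UNIV. cnj (v $ inv g (g i)) * A $ g i $ g j * v $ inv g (g j))"
    unfolding qform_def vec_lambda_beta r[symmetric] by (rule refl)
  also have "\<dots> = qform (rearrange g A) v"
    using g by (simp add: qform_def rearrange_def bij_is_inj)
  finally show "qform (rearrange g A) v \<in> \<real>\<^sub>\<ge>\<^sub>0" using A unfolding psd_iff by metis
qed

lemma trace_rearrange: "bij g \<Longrightarrow> trace (rearrange g A) = trace A"
  unfolding trace_def by (simp add: rearrange_def sum.reindex_bij_betw[of g UNIV UNIV "\<lambda>i. A $ i $ i"])

lemma density_rearrange: "bij g \<Longrightarrow> density A \<Longrightarrow> density (rearrange g A)"
  by (simp add: density_def psd_rearrange trace_rearrange)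

text \<open>The form of the partial trace at \<open>v\<close> is the sum of the forms of
  \<open>A\<close> at \<open>v\<close> tensored with each basis state of the traced
  register.\<close>

lemma psd_ptrace_snd:
  assumes "psd A"
  shows "psd (ptrace_snd A)"
  unfolding psd_iff
proof
  fix v
  have "qform (ptrace_snd A) v =
     (\<Sum>i\<in>UNIV. \<Sum>j\<in>UNIV. \<Sum>b\<in>UNIV. cnj (v $ i) * A $ (i, b) $ (j, b) * v $ j)"
    by (simp add: qform_def ptrace_snd_def sum_distrib_left sum_distrib_right)
  also have "\<dots> = (\<Sum>i\<in>UNIV. \<Sum>b\<in>UNIV. \<Sum>j\<in>UNIV. cnj (v $ i) * A $ (i, b) $ (j, b) * v $ j)"
    by (rule sum.cong[OF refl], rule sum.swap)
  also have "\<dots> = (\<Sum>b\<in>UNIV. \<Sum>i\<in>UNIV. \<Sum>j\<in>UNIV. cnj (v $ i) * A $ (i, b) $ (j, b) * v $ j)"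
    by (rule sum.swap)
  also have "\<dots> = (\<Sum>b\<in>UNIV. qform A (\<chi> k. if snd k = b then v $ fst k else 0))"
    by (rule sum.cong[OF refl])
       (simp add: qform_def sum_UNIV_prod if_distrib[of cnj] if_distrib[of "\<lambda>x. x * _"]
          if_distrib[of "\<lambda>x. _ * x"] sum_if_const cong: if_cong)
  also have "\<dots> \<in> \<real>\<^sub>\<ge>\<^sub>0"
    using assms unfolding psd_iff by (intro nonneg_Reals_sum) blast
  finally show "qform (ptrace_snd A) v \<in> \<real>\<^sub>\<ge>\<^sub>0" .
qed

lemma trace_ptrace_snd: "trace (ptrace_snd A) = trace A"
  by (simp add: trace_def ptrace_snd_def sum_UNIV_prod)

lemma density_ptrace_snd: "density A \<Longrightarrow> density (ptrace_snd A)"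
  by (simp add: density_def psd_ptrace_snd trace_ptrace_snd)

lemma ptrace_fst_eq: "ptrace_fst A = ptrace_snd (rearrange prod.swap A)"
  by (rule operator_eqI) (simp add: ptrace_fst_def ptrace_snd_def rearrange_def)

lemma density_ptrace_fst: "density A \<Longrightarrow> density (ptrace_fst A)"
  unfolding ptrace_fst_eq by (intro density_ptrace_snd density_rearrange) auto

lemma continuous_on_rearrange [continuous_intros]:
  "continuous_on S f \<Longrightarrow> continuous_on S (\<lambda>x. rearrange g (f x))"
  by (rule continuous_on_operatorI) (simp add: rearrange_def continuous_intros)

lemma continuous_on_ptrace_snd [continuous_intros]:
  "continuous_on S f \<Longrightarrow> continuous_on S (\<lambda>x. ptrace_snd (f x))"
  by (rule continuous_on_operatorI) (simp add: ptrace_snd_def continuous_intros)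

lemma continuous_on_ptrace_fst [continuous_intros]:
  "continuous_on S f \<Longrightarrow> continuous_on S (\<lambda>x. ptrace_fst (f x))"
  by (rule continuous_on_operatorI) (simp add: ptrace_fst_def continuous_intros)

lemma continuous_on_mutual_info: "continuous_on {A. density A} mutual_info"
  unfolding mutual_info_def
  by (intro continuous_intros continuous_on_compose2[OF continuous_on_entropy_op])
     (auto simp: density_ptrace_fst density_ptrace_snd)

lemma bij_regroup: "bij (\<lambda>((a, c), b). (a, b, c))"
  by (rule o_bij[of "\<lambda>(a, b, c). ((a, c), b)"]) auto

lemma continuous_on_cond_mutual_info: "continuous_on {A. density A} cond_mutual_info"
  unfolding cond_mutual_info_def
  by (intro continuous_intros continuous_on_mutual_info continuous_on_compose2[OF continuous_on_mutual_info])
     (auto simp: density_ptrace_snd density_rearrange bij_regroup)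

text \<open>Complete positivity is phrased for arrays indexed by numbers below \<open>k\<close>. An
  enumeration \<open>h\<close> of the reference register identifies an operator on the joint
  register with such an array.\<close>

lemma psd_id_tensor:
  fixes F :: "('a::finite) operator \<Rightarrow> ('b::finite) operator" and \<rho> :: "('r::finite \<times> 'a) operator"
  assumes F: "completely_positive F" and \<rho>: "psd \<rho>"
  shows "psd (id_tensor F \<rho>)"
proof -
  define k where "k = CARD('r)"
  obtain h :: "nat \<Rightarrow> 'r" where h: "bij_betw h {..<k} UNIV"
    using ex_bij_betw_nat_finite[of "UNIV :: 'r set"] by (auto simp: k_def atLeast0LessThan)
  define hi where "hi = the_inv_into {..<k} h"
  have hi: "hi (h i) = i" if "i < k" for i
    using h that unfolding hi_def by (simp add: bij_betw_def the_inv_into_f_f)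
  define blk where "blk r r' = op_of (\<lambda>a a'. \<rho> $ (r, a) $ (r', a'))" for r r'
  have re: "(\<Sum>i<k. \<Sum>j<k. f (h i) (h j)) = (\<Sum>r\<in>UNIV. \<Sum>r'\<in>UNIV. f r r')" for f :: "'r \<Rightarrow> 'r \<Rightarrow> complex"
    using sum.reindex_bij_betw[OF h, of "\<lambda>x. sum (f x) UNIV"]
    by (simp add: sum.reindex_bij_betw[OF h, of "f _"])
  have "block_psd k (\<lambda>i j. blk (h i) (h j))"
    unfolding block_psd_def Let_def
  proof
    fix v :: "nat \<Rightarrow> complex^'a"
    have "(\<Sum>i<k. \<Sum>j<k. \<Sum>r\<in>UNIV. \<Sum>s\<in>UNIV. cnj (v i $ r) * blk (h i) (h j) $ r $ s * v j $ s) =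
      (\<Sum>i<k. \<Sum>j<k. \<Sum>r\<in>UNIV. \<Sum>s\<in>UNIV. cnj (v (hi (h i)) $ r) * blk (h i) (h j) $ r $ s * v (hi (h j)) $ s)"
      by (intro sum.cong refl) (simp add: hi)
    also have "\<dots> = (\<Sum>x\<in>UNIV. \<Sum>y\<in>UNIV. \<Sum>r\<in>UNIV. \<Sum>s\<in>UNIV. cnj (v (hi x) $ r) * blk x y $ r $ s * v (hi y) $ s)"
      by (rule re)
    also have "\<dots> = (\<Sum>x\<in>UNIV. \<Sum>r\<in>UNIV. \<Sum>y\<in>UNIV. \<Sum>s\<in>UNIV. cnj (v (hi x) $ r) * blk x y $ r $ s * v (hi y) $ s)"
      by (rule sum.cong[OF refl], rule sum.swap)
    also have "\<dots> = qform \<rho> (\<chi> z. v (hi (fst z)) $ snd z)"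
      by (simp add: qform_def sum_UNIV_prod blk_def)
    finally show "(\<Sum>i<k. \<Sum>j<k. \<Sum>r\<in>UNIV. \<Sum>s\<in>UNIV. cnj (v i $ r) * blk (h i) (h j) $ r $ s * v j $ s) \<in> \<real> \<and>
      0 \<le> Re (\<Sum>i<k. \<Sum>j<k. \<Sum>r\<in>UNIV. \<Sum>s\<in>UNIV. cnj (v i $ r) * blk (h i) (h j) $ r $ s * v j $ s)"
      using \<rho> by (simp add: psd_iff complex_nonneg_Reals_iff complex_is_Real_iff)
  qed
  then have P: "block_psd k (\<lambda>i j. F (blk (h i) (h j)))"
    using F unfolding completely_positive_def by blast
  show ?thesis
    unfolding psd_iff
  proof
    fix w :: "complex^('r \<times> 'b)"
    have "qform (id_tensor F \<rho>) w = (\<Sum>x\<in>UNIV. \<Sum>r\<in>UNIV. \<Sum>y\<in>UNIV. \<Sum>s\<in>UNIV. cnj (w $ (x, r)) * F (blk x y) $ r $ s * w $ (y, s))"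
      by (simp add: qform_def sum_UNIV_prod blk_def id_tensor_def)
    also have "\<dots> = (\<Sum>x\<in>UNIV. \<Sum>y\<in>UNIV. \<Sum>r\<in>UNIV. \<Sum>s\<in>UNIV. cnj (w $ (x, r)) * F (blk x y) $ r $ s * w $ (y, s))"
      by (rule sum.cong[OF refl], rule sum.swap)
    also have "\<dots> = (\<Sum>i<k. \<Sum>j<k. \<Sum>r\<in>UNIV. \<Sum>s\<in>UNIV. cnj (w $ (h i, r)) * F (blk (h i) (h j)) $ r $ s * w $ (h j, s))"
      by (rule re[symmetric])
    also have "\<dots> \<in> \<real>\<^sub>\<ge>\<^sub>0"
      using P[unfolded block_psd_def Let_def, rule_format, of "\<lambda>i. \<chi> r. w $ (h i, r)"]
      by (simp add: complex_nonneg_Reals_iff complex_is_Real_iff)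
    finally show "qform (id_tensor F \<rho>) w \<in> \<real>\<^sub>\<ge>\<^sub>0" .
  qed
qed

lemma trace_id_tensor:
  assumes "\<And>A. trace (F A) = trace A"
  shows "trace (id_tensor F \<rho>) = trace \<rho>"
  using assms unfolding trace_def by (simp add: id_tensor_def sum_UNIV_prod)

lemma density_id_tensor: "cptp F \<Longrightarrow> density \<rho> \<Longrightarrow> density (id_tensor F \<rho>)"
  by (simp add: density_def cptp_def psd_id_tensor trace_id_tensor)

text \<open>Complete positivity with the one-dimensional reference register
  \<open>unit\<close>.\<close>

lemma psd_cptp:
  assumes "cptp F" "psd A"
  shows "psd (F A)"
proof -
  have g: "bij (\<lambda>x. ((), x))" by (rule o_bij[of snd]) auto
  have "psd (rearrange snd A :: (unit \<times> 'a) operator)"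
    by (rule psd_rearrange[OF _ assms(2)]) (rule o_bij[of "\<lambda>x. ((), x)"], auto)
  then have "psd (id_tensor F (rearrange snd A :: (unit \<times> 'a) operator))"
    using assms(1) by (intro psd_id_tensor) (auto simp: cptp_def)
  then have "psd (rearrange (\<lambda>x. ((), x)) (id_tensor F (rearrange snd A :: (unit \<times> 'a) operator)))"
    by (rule psd_rearrange[OF g])
  moreover have "op_of (\<lambda>a b. A $ a $ b) = A" by (rule operator_eqI) simp
  then have "rearrange (\<lambda>x. ((), x)) (id_tensor F (rearrange snd A :: (unit \<times> 'a) operator)) = F A"
    by (intro operator_eqI) (simp add: rearrange_def id_tensor_def)
  ultimately show ?thesis by simp
qed

section \<open>Compactness of sets of channels under pointwise convergence\<close>

lemma cptp_add: "cptp F \<Longrightarrow> F (A + B) = F A + F B"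
  by (simp add: cptp_def)

lemma cptp_scale: "cptp F \<Longrightarrow> F (map_matrix ((*) c) A) = map_matrix ((*) c) (F A)"
  by (simp add: cptp_def)

lemma cptp_trace: "cptp F \<Longrightarrow> trace (F A) = trace A"
  by (simp add: cptp_def)

text \<open>Polarization: \<open>4A = \<Sum>\<^sub>c c\<^sup>* (1 + cA)\<^sup>\<dagger>(1 + cA)\<close> over the fourth roots of unity \<open>c\<close>.\<close>

lemma operator_polarization:
  fixes A :: "('a::finite) operator"
  defines "B c \<equiv> dagger (mat 1 + map_matrix ((*) c) A) ** (mat 1 + map_matrix ((*) c) A)"
  shows "A = map_matrix ((*) (1/4)) (B 1) + map_matrix ((*) (-\<i>/4)) (B \<i>)
     + map_matrix ((*) (-1/4)) (B (-1)) + map_matrix ((*) (\<i>/4)) (B (-\<i>))"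
proof (rule operator_eqI)
  fix i j
  have B: "B c $ i $ j = (\<Sum>l\<in>UNIV. (mat 1 $ l $ i + cnj c * cnj (A $ l $ i)) * (mat 1 $ l $ j + c * A $ l $ j))" for c
    by (simp add: B_def matrix_matrix_mult_def mat_def if_distrib[of cnj] cong: if_cong)
  have "(map_matrix ((*) (1/4)) (B 1) + map_matrix ((*) (-\<i>/4)) (B \<i>)
     + map_matrix ((*) (-1/4)) (B (-1)) + map_matrix ((*) (\<i>/4)) (B (-\<i>))) $ i $ j
     = (\<Sum>l\<in>UNIV. mat 1 $ l $ i * A $ l $ j)"
    unfolding vector_add_component nth_map_matrix B sum_distrib_left sum.distrib[symmetric]
    by (rule sum.cong) (simp_all add: field_simps)
  also have "\<dots> = A $ i $ j"
    by (simp add: mat_def if_distrib[of "\<lambda>x. x * _"] cong: if_cong)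
  finally show "A $ i $ j = (map_matrix ((*) (1/4)) (B 1) + map_matrix ((*) (-\<i>/4)) (B \<i>)
     + map_matrix ((*) (-1/4)) (B (-1)) + map_matrix ((*) (\<i>/4)) (B (-\<i>))) $ i $ j" by simp
qed

text \<open>Polarization reduces to positive arguments, whose images are positive of the same trace.
  The bound depends on \<open>A\<close> but not on \<open>F\<close>, exactly what a product of
  compact sets needs.\<close>

lemma cptp_pointwise_bounded:
  fixes A :: "('a::finite) operator"
  shows "\<exists>M. \<forall>F :: 'a operator \<Rightarrow> ('b::finite) operator. cptp F \<longrightarrow> (\<forall>i j. cmod (F A $ i $ j) \<le> M)"
proof -
  define bdd where "bdd A \<longleftrightarrow> (\<exists>M. \<forall>F :: 'a operator \<Rightarrow> 'b operator. cptp F \<longrightarrow> (\<forall>i j. cmod (F A $ i $ j) \<le> M))"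
    for A :: "'a operator"
  have add: "bdd (A + B)" if "bdd A" "bdd B" for A B
  proof -
    obtain M N where "\<And>F :: 'a operator \<Rightarrow> 'b operator. cptp F \<Longrightarrow> (\<forall>i j. cmod (F A $ i $ j) \<le> M)"
      "\<And>F :: 'a operator \<Rightarrow> 'b operator. cptp F \<Longrightarrow> (\<forall>i j. cmod (F B $ i $ j) \<le> N)"
      using \<open>bdd A\<close> \<open>bdd B\<close> unfolding bdd_def by blast
    then show ?thesis unfolding bdd_def
      by (intro exI[of _ "M + N"] allI impI)
         (simp add: cptp_add order_trans[OF norm_triangle_ineq add_mono])
  qed
  have scale: "bdd (map_matrix ((*) c) A)" if bA: "bdd A" for c A
  proof -
    obtain M where "\<And>F :: 'a operator \<Rightarrow> 'b operator. cptp F \<Longrightarrow> (\<forall>i j. cmod (F A $ i $ j) \<le> M)"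
      using bA unfolding bdd_def by blast
    then show ?thesis unfolding bdd_def
      by (intro exI[of _ "cmod c * M"] allI impI) (simp add: cptp_scale norm_mult mult_left_mono)
  qed
  have psd: "bdd (dagger B ** B)" for B
    unfolding bdd_def
  proof (intro exI[of _ "Re (trace (dagger B ** B))"] allI impI)
    fix F :: "'a operator \<Rightarrow> 'b operator" and i j
    assume F: "cptp F"
    show "cmod (F (dagger B ** B) $ i $ j) \<le> Re (trace (dagger B ** B))"
      using psd_nth_le_trace[OF psd_cptp[OF F psd_dagger_mult[of B]], of i j] cptp_trace[OF F] by simp
  qed
  have "bdd A" by (subst operator_polarization) (intro add scale psd)
  then show ?thesis unfolding bdd_def .
qed

text \<open>Tychonoff's theorem: the topology on functions is that of pointwise convergence, so maps
  between operators can be handled without choosing coordinates for them.\<close>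

lemma compact_pointwise:
  assumes "\<And>i. compact (S i)"
  shows "compact {f :: 'i \<Rightarrow> 'y::topological_space. \<forall>i. f i \<in> S i}"
proof -
  have "compactin (product_topology (\<lambda>i. euclidean) UNIV) (Pi\<^sub>E UNIV S)"
    using assms by (subst compactin_PiE) auto
  moreover have "Pi\<^sub>E UNIV S = {f. \<forall>i. f i \<in> S i}" by (auto simp: PiE_def Pi_def)
  ultimately show ?thesis by (simp add: euclidean_product_topology)
qed

lemma continuous_on_apply [continuous_intros]:
  "continuous_on S (\<lambda>F :: 'i \<Rightarrow> 'y::topological_space. F i)"
  by (rule continuous_on_subset[OF continuous_on_product_coordinates]) simp

lemma continuous_on_id_tensor [continuous_intros]:
  "continuous_on S (\<lambda>F. id_tensor F \<rho>)"
  by (rule continuous_on_operatorI) (auto simp: id_tensor_def split: prod.split intro!: continuous_intros)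

text \<open>Each defining condition, once its arguments are fixed, constrains finitely many values
  of \<open>F\<close> by an equation or a weak inequality.\<close>

lemma closed_cptp: "closed {F :: ('a::finite) operator \<Rightarrow> ('b::finite) operator. cptp F}"
proof -
  have 1: "closed {F :: 'a operator \<Rightarrow> 'b operator. \<forall>A B. F (A + B) = F A + F B}"
    by (intro closed_Collect_all closed_Collect_eq) (rule continuous_intros)+
  have 2: "closed {F :: 'a operator \<Rightarrow> 'b operator. \<forall>c A. F (map_matrix ((*) c) A) = map_matrix ((*) c) (F A)}"
    by (intro closed_Collect_all closed_Collect_eq continuous_on_apply continuous_on_operatorI)
       (simp, (rule continuous_intros)+)
  have 3: "closed {F :: 'a operator \<Rightarrow> 'b operator. completely_positive F}"
    unfolding completely_positive_def
  proof (intro closed_Collect_all)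
    fix k and A :: "nat \<Rightarrow> nat \<Rightarrow> 'a operator"
    show "closed {F :: 'a operator \<Rightarrow> 'b operator. block_psd k A \<longrightarrow> block_psd k (\<lambda>i j. F (A i j))}"
    proof (cases "block_psd k A")
      case True
      have "closed {F :: 'a operator \<Rightarrow> 'b operator. block_psd k (\<lambda>i j. F (A i j))}"
        unfolding block_psd_def Let_def complex_is_Real_iff
        by (intro closed_Collect_all closed_Collect_conj closed_Collect_eq closed_Collect_le)
           (rule continuous_intros)+
      then show ?thesis using True by simp
    qed simp
  qed
  have 4: "closed {F :: 'a operator \<Rightarrow> 'b operator. \<forall>A. trace (F A) = trace A}"
    unfolding trace_def by (intro closed_Collect_all closed_Collect_eq) (rule continuous_intros)+
  show ?thesis unfolding cptp_def
    by (intro closed_Collect_conj 1 2 3 4)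
qed

lemma compact_feasible_map:
  fixes \<rho> :: "('x::finite \<times> 'c::finite) operator"
  shows "compact {F. feasible_map \<rho> \<epsilon> F}"
proof -
  obtain M where M: "\<And>F A i j. cptp F \<Longrightarrow> cmod ((F :: 'c operator \<Rightarrow> ('c \<times> 'c) operator) A $ i $ j) \<le> M A"
    using cptp_pointwise_bounded by metis
  \<comment> \<open>The factor at \<open>A\<close> is the closure of all values that channels take
    there, bounded by \<open>M A\<close> and hence compact.\<close>
  define S where "S A = closure {F A | F. cptp (F :: 'c operator \<Rightarrow> ('c \<times> 'c) operator)}" for A
  have "compact {F :: 'c operator \<Rightarrow> ('c \<times> 'c) operator. \<forall>A. F A \<in> S A}"
    unfolding S_def using M
    by (intro compact_pointwise) (auto simp: compact_closure intro!: bounded_operators)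
  moreover have "closed {F. feasible_map \<rho> \<epsilon> F}"
    unfolding feasible_map_def trace_dist_def
    by (intro closed_Collect_conj closed_cptp closed_Collect_le closed_Collect_eq)
       (rule continuous_intros continuous_on_compose2[OF continuous_on_trace_norm] subset_UNIV | simp)+
  ultimately have "compact ({F. \<forall>A. F A \<in> S A} \<inter> {F. feasible_map \<rho> \<epsilon> F})"
    by (rule compact_Int_closed)
  moreover have "F A \<in> S A" if "feasible_map \<rho> \<epsilon> F" for F A
    unfolding S_def using that by (intro subsetD[OF closure_subset]) (auto simp: feasible_map_def)
  then have "{F. \<forall>A. F A \<in> S A} \<inter> {F. feasible_map \<rho> \<epsilon> F} = {F. feasible_map \<rho> \<epsilon> F}" by blast
  ultimately show ?thesis by simp
qed

lemma bij_rotate: "bij (\<lambda>(c, c', x). (x, c, c'))"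
  by (rule o_bij[of "\<lambda>(x, c, c'). (c, c', x)"]) auto

text \<open>\<open>F0\<close> makes the compact set nonempty. Normalization of \<open>\<rho>\<close>
  keeps every state occurring in the cost in the domain where entropy is known to be
  continuous.\<close>

lemma feasible_arg_min_exists:
  assumes "density \<rho>" and "feasible_map \<rho> \<epsilon> F0"
  obtains F where "is_arg_min (map_cost \<rho>) (feasible_map \<rho> \<epsilon>) F"
proof -
  have "continuous_on {F. feasible_map \<rho> \<epsilon> F} (map_cost \<rho>)"
    unfolding map_cost_def
  proof (rule continuous_on_compose2[OF continuous_on_cond_mutual_info])
    show "continuous_on {F. feasible_map \<rho> \<epsilon> F} (\<lambda>F. rearrange (\<lambda>(c, c', x). (x, c, c')) (id_tensor F \<rho>))"
      by (intro continuous_on_rearrange continuous_on_id_tensor)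
    show "(\<lambda>F. rearrange (\<lambda>(c, c', x). (x, c, c')) (id_tensor F \<rho>)) ` {F. feasible_map \<rho> \<epsilon> F} \<subseteq> {A. density A}"
      unfolding feasible_map_def
      by (intro image_subsetI CollectI density_rearrange[OF bij_rotate] density_id_tensor[OF _ assms(1)]) simp
  qed
  then have "\<exists>F\<in>{F. feasible_map \<rho> \<epsilon> F}. \<forall>G\<in>{F. feasible_map \<rho> \<epsilon> F}. map_cost \<rho> F \<le> map_cost \<rho> G"
    using assms(2) by (intro continuous_attains_inf[OF compact_feasible_map]) blast+
  then obtain F where F: "feasible_map \<rho> \<epsilon> F" and min: "\<And>G. feasible_map \<rho> \<epsilon> G \<Longrightarrow> map_cost \<rho> F \<le> map_cost \<rho> G"
    by blast
  show thesis
    by (rule that[of F]) (auto simp: is_arg_min_def F dest: min)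
qed

subsection \<open>Classical entropies\<close>

lemma gibbs:
  fixes p q :: "'z \<Rightarrow> real"
  assumes "\<And>z. z \<in> S \<Longrightarrow> 0 \<le> p z" "\<And>z. z \<in> S \<Longrightarrow> 0 \<le> q z"
    and "\<And>z. z \<in> S \<Longrightarrow> 0 < p z \<Longrightarrow> 0 < q z" and "sum q S \<le> sum p S"
  shows "(\<Sum>z\<in>S. p z * log 2 (q z / p z)) \<le> 0"
proof -
  have "(\<Sum>z\<in>S. p z * log 2 (q z / p z)) \<le> (\<Sum>z\<in>S. (q z - p z) / ln 2)"
  proof (rule sum_mono)
    fix z assume z: "z \<in> S"
    show "p z * log 2 (q z / p z) \<le> (q z - p z) / ln 2"
    proof (cases "p z = 0")
      case True
      then show ?thesis using assms(2)[OF z] by simp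
    next
      case False
      then have p: "p z > 0" "q z > 0" using assms(1,3)[OF z] by auto
      have "p z * ln (q z / p z) \<le> p z * (q z / p z - 1)"
        using p by (intro mult_left_mono ln_le_minus_one) auto
      also have "\<dots> = q z - p z" using p by (simp add: field_simps)
      finally show ?thesis by (simp add: log_def divide_right_mono)
    qed
  qed
  also have "\<dots> = (sum q S - sum p S) / ln 2" by (simp add: sum_subtractf flip: sum_divide_distrib)
  also have "\<dots> \<le> 0" using assms(4) by (simp add: divide_le_0_iff)
  finally show ?thesis .
qed

text \<open>The contribution to \<open>H(X|C)\<close> of one value of \<open>C\<close>, where \<open>u\<close> is the unnormalized conditional weight.\<close>

definition column_entropy :: "('x::finite \<Rightarrow> real) \<Rightarrow> real" where
  "column_entropy u = (\<Sum>x\<in>UNIV. u x * log 2 (sum u UNIV / u x))"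

lemma member_le_sum_UNIV: "(\<And>x. 0 \<le> u x) \<Longrightarrow> u x \<le> sum u UNIV" for u :: "'x::finite \<Rightarrow> real"
  by (rule member_le_sum) auto

lemma mult_log_divide:
  "0 \<le> a \<Longrightarrow> (0 < a \<Longrightarrow> 0 < b) \<Longrightarrow> (0 < a \<Longrightarrow> 0 < c) \<Longrightarrow> a * log 2 (b / c) = a * log 2 b - a * log 2 c" for a :: real
  by (cases "a = 0") (auto simp: log_divide right_diff_distrib)

lemma column_entropy_eq:
  assumes "\<And>x. 0 \<le> u x"
  shows "column_entropy u = sum u UNIV * log 2 (sum u UNIV) - (\<Sum>x\<in>UNIV. u x * log 2 (u x))"
proof -
  have "u x * log 2 (sum u UNIV / u x) = u x * log 2 (sum u UNIV) - u x * log 2 (u x)" for x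
    using assms[of x] member_le_sum_UNIV[of u x, OF assms] by (intro mult_log_divide) auto
  then show ?thesis by (simp add: column_entropy_def sum_subtractf sum_distrib_right)
qed

text \<open>The partial derivatives \<open>log 2 (sum u UNIV / u x)\<close> are nonnegative. Instead
  of differentiating, the proof compares \<open>u\<close> with \<open>v\<close> through the cross
  entropy.\<close>

lemma column_entropy_mono:
  assumes "\<And>x. 0 \<le> u x" "\<And>x. u x \<le> v x"
  shows "column_entropy u \<le> column_entropy v"
proof (cases "sum u UNIV = 0")
  case True
  then have "u x = 0" for x using assms(1) by (simp add: sum_nonneg_eq_0_iff)
  moreover have "0 \<le> column_entropy v"
    unfolding column_entropy_def
  proof (intro sum_nonneg)
    fix x
    have "0 \<le> v x" "v x \<le> sum v UNIV"
      using assms order_trans member_le_sum_UNIV by (blast, meson order_trans member_le_sum_UNIV)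
    then show "0 \<le> v x * log 2 (sum v UNIV / v x)"
      by (cases "v x = 0") (auto intro!: mult_nonneg_nonneg)
  qed
  ultimately show ?thesis by (simp add: column_entropy_def)
next
  case False
  define M where "M = sum u UNIV"
  define P where "P = sum v UNIV"
  have v: "0 \<le> v x" for x using assms order_trans by blast
  have M: "0 < M" using False assms(1) by (simp add: M_def less_le sum_nonneg)
  have MP: "M \<le> P" unfolding M_def P_def by (rule sum_mono) (rule assms)
  have vP: "v x \<le> P" for x unfolding P_def by (rule member_le_sum_UNIV[OF v])
  \<comment> \<open>Gibbs against \<open>v\<close> rescaled to the mass of \<open>u\<close>;
    replacing \<open>u\<close> by \<open>v\<close> in front of the nonnegative logarithms
    \<open>log 2 (P / v x)\<close> then finishes.\<close>
  have "(\<Sum>x\<in>UNIV. u x * log 2 ((v x * M / P) / u x)) \<le> 0"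
  proof (rule gibbs)
    show "(\<Sum>x\<in>UNIV. v x * M / P) \<le> sum u UNIV"
      using M MP by (simp add: M_def[symmetric] P_def[symmetric] flip: sum_divide_distrib sum_distrib_right)
    show "0 < u x \<Longrightarrow> 0 < v x * M / P" for x using M MP assms(2)[of x] by simp
  qed (use M MP v assms in auto)
  moreover have "u x * log 2 (M / u x) \<le> v x * log 2 (P / v x) + u x * log 2 ((v x * M / P) / u x)" for x
  proof (cases "u x = 0")
    case True
    then show ?thesis using v[of x] vP[of x] by (cases "v x = 0") (auto intro!: mult_nonneg_nonneg)
  next
    case False
    then have pos: "0 < u x" "0 < v x" using assms(1)[of x] assms(2)[of x] by auto
    have "M / u x = (P / v x) * ((v x * M / P) / u x)" using pos M MP by (simp add: field_simps)
    also have "log 2 \<dots> = log 2 (P / v x) + log 2 ((v x * M / P) / u x)"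
      using pos M MP by (subst log_mult) auto
    finally have "log 2 (M / u x) = log 2 (P / v x) + log 2 ((v x * M / P) / u x)" .
    moreover have "u x * log 2 (P / v x) \<le> v x * log 2 (P / v x)"
      using pos vP[of x] assms(2)[of x] by (intro mult_right_mono) auto
    ultimately show ?thesis by (simp add: distrib_left)
  qed
  then have "column_entropy u \<le> (\<Sum>x\<in>UNIV. v x * log 2 (P / v x) + u x * log 2 ((v x * M / P) / u x))"
    unfolding column_entropy_def M_def[symmetric] by (rule sum_mono)
  ultimately show ?thesis by (simp add: column_entropy_def P_def[symmetric] sum.distrib)
qed

text \<open>Gibbs against the uniform weight of the same total mass.\<close>

lemma column_entropy_le:
  fixes u :: "'x::finite \<Rightarrow> real"
  assumes "\<And>x. 0 \<le> u x"
  shows "column_entropy u \<le> sum u UNIV * log 2 CARD('x)"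
proof (cases "sum u UNIV = 0")
  case True
  then have "u x = 0" for x using assms by (simp add: sum_nonneg_eq_0_iff)
  then show ?thesis by (simp add: column_entropy_def)
next
  case False
  define M where "M = sum u UNIV"
  have M: "0 < M" using False assms by (simp add: M_def less_le sum_nonneg)
  have "(\<Sum>x\<in>UNIV. u x * log 2 ((M / CARD('x)) / u x)) \<le> 0"
    by (rule gibbs) (use M assms in \<open>auto simp: M_def\<close>)
  moreover have "u x * log 2 (M / u x) = u x * log 2 ((M / CARD('x)) / u x) + u x * log 2 CARD('x)" for x
    using M assms[of x] by (cases "u x = 0") (auto simp: log_divide log_mult algebra_simps)
  ultimately show ?thesis
    by (simp add: column_entropy_def M_def[symmetric] sum.distrib flip: sum_distrib_right)
qed

text \<open>A sum is a mixture with a forgotten flag telling which summand a value came from.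
  Keeping the flag costs at most one bit per unit of mass; this is the origin of the final constant
  1.\<close>

lemma column_entropy_add_le:
  assumes m: "\<And>x. 0 \<le> m x" and r: "\<And>x. 0 \<le> r x"
  shows "column_entropy (\<lambda>x. m x + r x) \<le> column_entropy m + column_entropy r + (sum m UNIV + sum r UNIV)"
proof -
  define M R where "M = sum m UNIV" and "R = sum r UNIV"
  have M: "0 \<le> M" "m x \<le> M" for x using m by (auto simp: M_def sum_nonneg member_le_sum_UNIV)
  have R: "0 \<le> R" "r x \<le> R" for x using r by (auto simp: R_def sum_nonneg member_le_sum_UNIV)
  \<comment> \<open>Dropping \<open>b\<close> from the denominator bounds one summand's contribution
    by its own entropy plus its share of the entropy of the flag.\<close>
  have le: "a * log 2 ((A + B) / (a + b)) \<le> a * log 2 (A / a) + a * log 2 ((A + B) / A)"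
    if "0 \<le> a" "a \<le> A" "0 \<le> b" "0 \<le> B" for a b A B :: real
  proof (cases "a = 0")
    case False
    then have pos: "0 < a" "0 < A" using that by auto
    have "log 2 ((A + B) / (a + b)) \<le> log 2 ((A + B) / a)"
      using pos that by (intro log_mono) (auto intro!: divide_left_mono)
    also have "(A + B) / a = (A / a) * ((A + B) / A)" using pos by (simp add: field_simps)
    also have "log 2 \<dots> = log 2 (A / a) + log 2 ((A + B) / A)"
      using pos that by (subst log_mult) auto
    finally show ?thesis using that(1) by (simp add: mult_left_mono flip: distrib_left)
  qed simp
  have S: "(\<Sum>x\<in>UNIV. m x + r x) = M + R" by (simp add: M_def R_def sum.distrib)
  have "column_entropy (\<lambda>x. m x + r x) =
     (\<Sum>x\<in>UNIV. m x * log 2 ((M + R) / (m x + r x)) + r x * log 2 ((R + M) / (r x + m x)))"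
    unfolding column_entropy_def S by (simp add: algebra_simps)
  also have "\<dots> \<le> (\<Sum>x\<in>UNIV. (m x * log 2 (M / m x) + m x * log 2 ((M + R) / M))
       + (r x * log 2 (R / r x) + r x * log 2 ((R + M) / R)))"
    using m r M R by (intro sum_mono add_mono le)
  also have "\<dots> = column_entropy m + column_entropy r + (M * log 2 ((M + R) / M) + R * log 2 ((R + M) / R))"
    by (simp add: column_entropy_def M_def[symmetric] R_def[symmetric] sum.distrib flip: sum_distrib_right)
  also have "M * log 2 ((M + R) / M) + R * log 2 ((R + M) / R) \<le> M + R"
  proof -
    \<comment> \<open>The binary entropy bound: Gibbs on two points against equal halves of the
      total mass.\<close>
    define p where "p b = (if b then M else R)" for b
    have "(\<Sum>b\<in>UNIV. p b * log 2 (((M + R) / 2) / p b)) \<le> 0"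
      by (rule gibbs) (use M R in \<open>auto simp: p_def UNIV_bool split: if_splits\<close>)
    moreover have "a * log 2 ((M + R) / a) = a * log 2 (((M + R) / 2) / a) + a"
      if "0 \<le> a" "a \<le> M + R" for a
      using that by (cases "a = 0") (auto simp: log_divide log_mult algebra_simps)
    from this[of M] this[of R]
    have "M * log 2 ((M + R) / M) = M * log 2 (((M + R) / 2) / M) + M"
      "R * log 2 ((M + R) / R) = R * log 2 (((M + R) / 2) / R) + R" using M R by auto
    ultimately show ?thesis by (simp add: p_def UNIV_bool add.commute)
  qed
  finally show ?thesis by (simp add: M_def R_def)
qed

section \<open>Shannon entropy, pushforwards and continuity of conditional entropy\<close>

definition shannon :: "('a::finite \<Rightarrow> real) \<Rightarrow> real" where
  "shannon f = - (\<Sum>a\<in>UNIV. f a * log 2 (f a))"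

text \<open>Pushforward along \<open>g\<close>: a single notion for projections of pairs and triples
  and for extracting one letter of a sequence, composed by \<open>marg_marg\<close>.\<close>

definition marg :: "('z::finite \<Rightarrow> 'k) \<Rightarrow> ('z \<Rightarrow> real) \<Rightarrow> 'k \<Rightarrow> real" where
  "marg g F k = (\<Sum>z | g z = k. F z)"

lemma marg_nonneg: "(\<And>z. 0 \<le> F z) \<Longrightarrow> 0 \<le> marg g F k"
  by (simp add: marg_def sum_nonneg)

lemma marg_ge: "(\<And>z. 0 \<le> F z) \<Longrightarrow> F z \<le> marg g F (g z)"
  unfolding marg_def by (rule member_le_sum) auto

lemma sum_marg: "(\<Sum>k\<in>UNIV. marg g F k * f k) = (\<Sum>z\<in>UNIV. F z * f (g z))" for g :: "'z::finite \<Rightarrow> 'k::finite"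
proof -
  have "(\<Sum>k\<in>UNIV. marg g F k * f k) = (\<Sum>k\<in>UNIV. \<Sum>z | z \<in> UNIV \<and> g z = k. F z * f (g z))"
    by (simp add: marg_def sum_distrib_right)
  also have "\<dots> = (\<Sum>z\<in>UNIV. F z * f (g z))" by (rule sum.group) auto
  finally show ?thesis .
qed

lemma sum_marg_1: "(\<Sum>k\<in>UNIV. marg g F k) = (\<Sum>z\<in>UNIV. F z)" for g :: "'z::finite \<Rightarrow> 'k::finite"
  using sum_marg[of g F "\<lambda>_. 1"] by simp

lemma marg_marg: "marg h (marg g F) = marg (h \<circ> g) F" for g :: "'z::finite \<Rightarrow> 'k::finite"
proof
  fix k
  have "marg h (marg g F) k = (\<Sum>y\<in>UNIV. marg g F y * (if h y = k then 1 else 0))"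
    unfolding marg_def[of h] by (rule sum.mono_neutral_cong_left) auto
  also have "\<dots> = (\<Sum>z\<in>UNIV. F z * (if h (g z) = k then 1 else 0))" by (rule sum_marg)
  also have "\<dots> = marg (h \<circ> g) F k"
    unfolding marg_def by (rule sum.mono_neutral_cong_right) auto
  finally show "marg h (marg g F) k = marg (h \<circ> g) F k" .
qed

lemma marg_fst: "marg fst f = (\<lambda>a. \<Sum>b\<in>UNIV. f (a, b))" for f :: "'a::finite \<times> 'b::finite \<Rightarrow> real"
proof
  fix a
  have "{z :: 'a \<times> 'b. fst z = a} = Pair a ` UNIV" by (auto simp: image_def)
  then show "marg fst f a = (\<Sum>b\<in>UNIV. f (a, b))"
    by (simp add: marg_def sum.reindex inj_on_def)
qed

lemma marg_snd: "marg snd f = (\<lambda>b. \<Sum>a\<in>UNIV. f (a, b))" for f :: "'a::finite \<times> 'b::finite \<Rightarrow> real"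
proof
  fix b
  have "{z :: 'a \<times> 'b. snd z = b} = (\<lambda>a. (a, b)) ` UNIV" by (auto simp: image_def)
  then show "marg snd f b = (\<Sum>a\<in>UNIV. f (a, b))"
    by (simp add: marg_def sum.reindex inj_on_def)
qed

text \<open>The chain rule: the left side is H(X|C), resolved into its columns.\<close>

lemma shannon_pair:
  fixes f :: "'x::finite \<times> 'c::finite \<Rightarrow> real"
  assumes "\<And>z. 0 \<le> f z"
  shows "shannon f - shannon (marg snd f) = (\<Sum>c\<in>UNIV. column_entropy (\<lambda>x. f (x, c)))"
proof -
  have "(\<Sum>c\<in>UNIV. column_entropy (\<lambda>x. f (x, c))) =
     (\<Sum>c\<in>UNIV. marg snd f c * log 2 (marg snd f c)) - (\<Sum>c\<in>UNIV. \<Sum>x\<in>UNIV. f (x, c) * log 2 (f (x, c)))"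
    using assms by (simp add: column_entropy_eq marg_snd sum_subtractf)
  also have "(\<Sum>c\<in>UNIV. \<Sum>x\<in>UNIV. f (x, c) * log 2 (f (x, c))) = (\<Sum>z\<in>UNIV. f z * log 2 (f z))"
    unfolding sum_UNIV_prod by (rule sum.swap)
  finally show ?thesis by (simp add: shannon_def)
qed

text \<open>Split \<open>w\<close> into \<open>min w r\<close> and the excess \<open>w - min w r\<close>, whose mass is at most \<open>\<epsilon>\<close>.\<close>

lemma conditional_entropy_continuity:
  fixes w r :: "'x::finite \<times> 'c::finite \<Rightarrow> real"
  assumes w: "\<And>z. 0 \<le> w z" and r: "\<And>z. 0 \<le> r z"
    and "sum w UNIV = 1" "sum r UNIV = 1" and d: "(\<Sum>z\<in>UNIV. \<bar>w z - r z\<bar>) \<le> 2 * \<epsilon>"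
  shows "shannon w - shannon (marg snd w) \<le> shannon r - shannon (marg snd r) + \<epsilon> * log 2 CARD('x) + 1"
proof -
  define m where "m z = min (w z) (r z)" for z
  define s where "s z = w z - m z" for z
  have m: "0 \<le> m z" "m z \<le> r z" and s: "0 \<le> s z" and ms: "w z = m z + s z" for z
    using w r by (auto simp: m_def s_def)
  \<comment> \<open>The excess is the positive part of \<open>w - r\<close>; as both have mass 1, it
    carries half of the l1 distance.\<close>
  have "s z = (\<bar>w z - r z\<bar> + w z - r z) / 2" for z by (auto simp: s_def m_def min_def)
  then have "sum s UNIV = (\<Sum>z\<in>UNIV. (\<bar>w z - r z\<bar> + w z - r z) / 2)"
    by (intro sum.cong refl)
  then have "sum s UNIV = ((\<Sum>z\<in>UNIV. \<bar>w z - r z\<bar>) + sum w UNIV - sum r UNIV) / 2"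
    by (simp only: sum.distrib sum_subtractf sum_divide_distrib[symmetric])
  then have se: "sum s UNIV \<le> \<epsilon>" using assms by simp
  have sw: "sum m UNIV + sum s UNIV = 1" using assms(3) ms by (simp add: sum.distrib)
  have "(\<Sum>c\<in>UNIV. column_entropy (\<lambda>x. w (x, c))) \<le> (\<Sum>c\<in>UNIV. column_entropy (\<lambda>x. m (x, c)) + column_entropy (\<lambda>x. s (x, c))
      + ((\<Sum>x\<in>UNIV. m (x, c)) + (\<Sum>x\<in>UNIV. s (x, c))))"
    unfolding ms using m s by (intro sum_mono column_entropy_add_le) auto
  \<comment> \<open>The common part is below \<open>r\<close>, so monotonicity applies; the excess
    is charged log |X| per unit of mass.\<close>
  also have "\<dots> \<le> (\<Sum>c\<in>UNIV. column_entropy (\<lambda>x. r (x, c)) + (\<Sum>x\<in>UNIV. s (x, c)) * log 2 CARD('x)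
      + ((\<Sum>x\<in>UNIV. m (x, c)) + (\<Sum>x\<in>UNIV. s (x, c))))"
    using m s by (intro sum_mono add_mono column_entropy_mono column_entropy_le order_refl) auto
  also have "\<dots> = (\<Sum>c\<in>UNIV. column_entropy (\<lambda>x. r (x, c))) + sum s UNIV * log 2 CARD('x)
     + (sum m UNIV + sum s UNIV)"
    unfolding sum.distrib sum_UNIV_prod sum_distrib_right[symmetric]
    by (simp add: sum.swap[of _ "UNIV :: 'c set" "UNIV :: 'x set"])
  also have "\<dots> \<le> (\<Sum>c\<in>UNIV. column_entropy (\<lambda>x. r (x, c))) + \<epsilon> * log 2 CARD('x) + 1"
    using se sw by (auto intro!: mult_right_mono)
  finally show ?thesis using shannon_pair[of w, OF w] shannon_pair[of r, OF r] by simp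
qed

lemma prod_sum_UNIV:
  fixes f :: "'n::finite \<Rightarrow> 'a::finite \<Rightarrow> real"
  shows "(\<Sum>g\<in>UNIV. \<Prod>j\<in>UNIV. f j (g j)) = (\<Prod>j\<in>UNIV. \<Sum>a\<in>UNIV. f j a)"
  using prod_sum_PiE[of "UNIV :: 'n set" "\<lambda>_. UNIV :: 'a set" f] by simp

text \<open>Independent letters from \<open>r\<close> whose second components alone enter
  \<open>\<kappa>\<close>: the sequences \<open>xs\<close>, \<open>cs\<close>, \<open>bs\<close>
  form a Markov chain.\<close>

locale product_source =
  fixes r :: "'x::finite \<times> 'c::finite \<Rightarrow> real"
    and \<kappa> :: "('n::finite \<Rightarrow> 'c) \<Rightarrow> ('n \<Rightarrow> 'b::finite) \<Rightarrow> real"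
  assumes r: "\<And>z. 0 \<le> r z" and r1: "sum r UNIV = 1"
    and \<kappa>: "\<And>cs bs. 0 \<le> \<kappa> cs bs" and \<kappa>1: "\<And>cs. (\<Sum>bs\<in>UNIV. \<kappa> cs bs) = 1"
begin

definition joint :: "('n \<Rightarrow> 'x) \<times> ('n \<Rightarrow> 'c) \<times> ('n \<Rightarrow> 'b) \<Rightarrow> real" where
  "joint = (\<lambda>(xs, cs, bs). (\<Prod>j\<in>UNIV. r (xs j, cs j)) * \<kappa> cs bs)"

definition letter :: "'n \<Rightarrow> 'x \<times> 'c \<times> 'b \<Rightarrow> real" where
  "letter i = marg (\<lambda>(xs, cs, bs). (xs i, cs i, bs i)) joint"

definition out :: "'n \<Rightarrow> 'b \<Rightarrow> real" where
  "out i = marg (snd \<circ> snd) (letter i)"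

lemma joint_nonneg: "0 \<le> joint z"
  using r \<kappa> by (auto simp: joint_def prod_nonneg split: prod.split)

lemma letter_nonneg: "0 \<le> letter i k"
  unfolding letter_def by (intro marg_nonneg joint_nonneg)

lemma sum_joint: "sum joint UNIV = 1"
proof -
  have "sum joint UNIV = (\<Sum>xs\<in>UNIV. \<Sum>cs\<in>UNIV. \<Prod>j\<in>(UNIV :: 'n set). r (xs j, cs j))"
    by (simp add: sum_UNIV_prod joint_def \<kappa>1 sum_distrib_left[symmetric])
  also have "\<dots> = (\<Sum>xs\<in>UNIV. \<Prod>j\<in>(UNIV :: 'n set). \<Sum>c\<in>UNIV. r (xs j, c))"
    by (rule sum.cong[OF refl]) (rule prod_sum_UNIV)
  also have "\<dots> = (\<Prod>j\<in>(UNIV :: 'n set). \<Sum>x\<in>UNIV. \<Sum>c\<in>UNIV. r (x, c))"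
    by (rule prod_sum_UNIV)
  finally show ?thesis using r1 by (simp add: sum_UNIV_prod)
qed

lemma sum_letter: "sum (letter i) UNIV = 1"
  unfolding letter_def sum_marg_1 by (rule sum_joint)

lemma out_eq: "out i b = (\<Sum>x\<in>UNIV. \<Sum>c\<in>UNIV. letter i (x, c, b))"
proof -
  have "out i b = marg snd (marg snd (letter i)) b" unfolding out_def marg_marg ..
  also have "\<dots> = (\<Sum>c\<in>UNIV. \<Sum>x\<in>UNIV. letter i (x, c, b))"
    by (simp add: marg_snd)
  finally show ?thesis by (simp add: sum.swap[of _ "UNIV :: 'c set" "UNIV :: 'x set"])
qed

lemma letter_le_out: "letter i (x, c, b) \<le> out i b"
  using marg_ge[of "letter i" "(x, c, b)" "snd \<circ> snd", OF letter_nonneg] by (simp add: out_def)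

lemma out_nonneg: "0 \<le> out i b"
  unfolding out_def by (intro marg_nonneg letter_nonneg)

text \<open>Gibbs' inequality against \<open>\<prod>\<^sub>i P(x\<^sub>i c\<^sub>i | b\<^sub>i) \<cdot> K(b) / T\<close>.\<close>

lemma sum_letter_info_le:
  assumes K: "\<And>cs bs. \<kappa> cs bs \<le> K bs" and T: "sum K UNIV = T"
  shows "(\<Sum>i\<in>UNIV. \<Sum>k\<in>UNIV. letter i k * log 2 (letter i k / (r (fst k, fst (snd k)) * out i (snd (snd k)))))
     \<le> log 2 T"
proof -
  \<comment> \<open>\<open>f\<close> is the posterior of a letter given its output, \<open>g\<close>
    the ratio inside its information density, and \<open>q\<close> the comparison law for Gibbs'
    inequality.\<close>
  define f where "f i k = letter i k / out i (snd (snd k))" for i k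
  define g where "g i k = letter i k / (r (fst k, fst (snd k)) * out i (snd (snd k)))" for i k
  define h where "h i z = (case z of (xs, cs, bs) \<Rightarrow> (xs i, cs i, bs i))"
    for i :: 'n and z :: "('n \<Rightarrow> 'x) \<times> ('n \<Rightarrow> 'c) \<times> ('n \<Rightarrow> 'b)"
  define q where "q z = K (snd (snd z)) / T * (\<Prod>i\<in>UNIV. f i (h i z))" for z
  have K0: "0 \<le> K bs" for bs using K[of _ bs] \<kappa> order_trans by blast
  have "1 \<le> T" unfolding T[symmetric] \<kappa>1[of undefined, symmetric] by (rule sum_mono) (rule K)
  then have T0: "0 < T" by simp
  have f0: "0 \<le> f i k" for i k by (simp add: f_def letter_nonneg out_nonneg)
  have q0: "0 \<le> q z" for z using K0 T0 f0 by (simp add: q_def prod_nonneg)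
  \<comment> \<open>The sum is 1, except when \<open>out i b = 0\<close>: division by zero then
    makes it 0.\<close>
  have fsum: "(\<Sum>x\<in>UNIV. \<Sum>c\<in>UNIV. f i (x, c, b)) \<le> 1" for i b
    by (simp add: f_def flip: sum_divide_distrib out_eq)
  have q1: "sum q UNIV \<le> 1"
  proof -
    have "sum q UNIV = (\<Sum>xs\<in>UNIV. \<Sum>cs\<in>UNIV. \<Sum>bs\<in>UNIV. K bs / T * (\<Prod>i\<in>UNIV. f i (xs i, cs i, bs i)))"
      by (simp add: sum_UNIV_prod q_def h_def)
    also have "\<dots> = (\<Sum>xs\<in>UNIV. \<Sum>bs\<in>UNIV. \<Sum>cs\<in>UNIV. K bs / T * (\<Prod>i\<in>UNIV. f i (xs i, cs i, bs i)))"
      by (rule sum.cong[OF refl], rule sum.swap)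
    also have "\<dots> = (\<Sum>bs\<in>UNIV. \<Sum>xs\<in>UNIV. \<Sum>cs\<in>UNIV. K bs / T * (\<Prod>i\<in>UNIV. f i (xs i, cs i, bs i)))"
      by (rule sum.swap)
    also have "\<dots> = (\<Sum>bs\<in>UNIV. K bs / T * (\<Prod>i\<in>UNIV. \<Sum>x\<in>UNIV. \<Sum>c\<in>UNIV. f i (x, c, bs i)))"
      unfolding sum_distrib_left[symmetric]
      by (subst prod_sum_UNIV[of "\<lambda>i x. \<Sum>c\<in>UNIV. f i (x, c, _ i)", symmetric])
         (simp add: prod_sum_UNIV[of "\<lambda>i c. f i (_ i, c, _ i)"])
    also have "\<dots> \<le> (\<Sum>bs\<in>UNIV. K bs / T * 1)"
      using fsum f0 K0 T0 by (intro sum_mono mult_left_mono prod_le_1) (auto intro!: sum_nonneg)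
    also have "\<dots> = 1" using T T0 by (simp flip: sum_divide_distrib)
    finally show ?thesis .
  qed
  \<comment> \<open>Positivity of \<open>joint z\<close> makes every factor positive, so the
    logarithm splits. The quotient is \<open>K bs / (T * \<kappa> cs bs)\<close> times the product
    of the \<open>g\<close>, and \<open>\<kappa> cs bs \<le> K bs\<close> makes the first factor at
    least \<open>1 / T\<close>.\<close>
  have pos: "0 < q z \<and> (\<Sum>i\<in>UNIV. log 2 (g i (h i z))) \<le> log 2 (q z / joint z) + log 2 T"
    if z: "0 < joint z" for z
  proof -
    obtain xs cs bs where zz: "z = (xs, cs, bs)" by (metis surj_pair)
    have P: "0 < (\<Prod>j\<in>UNIV. r (xs j, cs j))" and kp: "0 < \<kappa> cs bs"
      using z r \<kappa>[of cs bs] prod_nonneg[of UNIV "\<lambda>j. r (xs j, cs j)"]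
      by (auto simp: zz joint_def less_le)
    have rp: "0 < r (xs j, cs j)" for j
      using P r[of "(xs j, cs j)"] by (auto simp: less_le)
    have lp: "0 < letter i (xs i, cs i, bs i)" for i
      using marg_ge[of joint z "\<lambda>(xs, cs, bs). (xs i, cs i, bs i)", OF joint_nonneg] z
      by (simp add: letter_def zz)
    have op: "0 < out i (bs i)" for i using lp[of i] letter_le_out[of i] by (rule order_less_le_trans)
    have Kp: "0 < K bs" using kp K[of cs bs] by simp
    have fp: "0 < f i (h i z)" for i by (simp add: f_def h_def zz lp op)
    have qp: "0 < q z" unfolding q_def zz using Kp T0 fp by (simp add: prod_pos zz)
    have "q z / joint z = K bs / (T * \<kappa> cs bs) * (\<Prod>i\<in>UNIV. g i (h i z))"
      by (simp add: q_def zz joint_def f_def g_def h_def prod_dividef prod.distrib)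
    moreover have gp: "0 < g i (h i z)" for i by (simp add: g_def h_def zz lp op rp)
    moreover have "log 2 (\<Prod>i\<in>UNIV. g i (h i z)) = (\<Sum>i\<in>UNIV. log 2 (g i (h i z)))"
      unfolding log_def using gp by (subst ln_prod) (auto simp: sum_divide_distrib less_le)
    moreover have "0 < (\<Prod>i\<in>UNIV. g i (h i z))" using gp by (intro prod_pos) auto
    moreover have "0 < K bs / (T * \<kappa> cs bs)" using Kp T0 kp by simp
    ultimately have "log 2 (q z / joint z) = log 2 (K bs / (T * \<kappa> cs bs)) + (\<Sum>i\<in>UNIV. log 2 (g i (h i z)))"
      by (simp only: log_mult less_imp_neq[THEN not_sym] if_True simp_thms)
    moreover have "log 2 (1 / T) \<le> log 2 (K bs / (T * \<kappa> cs bs))"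
      using K[of cs bs] T0 kp Kp by (intro log_mono) (auto simp: field_simps)
    then have "- log 2 T \<le> log 2 (K bs / (T * \<kappa> cs bs))" using T0 by (simp add: log_divide)
    ultimately show ?thesis using qp by simp
  qed
  have G: "(\<Sum>z\<in>UNIV. joint z * log 2 (q z / joint z)) \<le> 0"
    using q0 joint_nonneg pos q1 sum_joint by (intro gibbs) auto
  have "(\<Sum>i\<in>UNIV. \<Sum>k\<in>UNIV. letter i k * log 2 (g i k)) = (\<Sum>i\<in>UNIV. \<Sum>z\<in>UNIV. joint z * log 2 (g i (h i z)))"
    by (simp add: letter_def sum_marg h_def case_prod_beta)
  also have "\<dots> = (\<Sum>z\<in>UNIV. joint z * (\<Sum>i\<in>UNIV. log 2 (g i (h i z))))"
    by (subst sum.swap) (simp add: sum_distrib_left)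
  also have "\<dots> \<le> (\<Sum>z\<in>UNIV. joint z * (log 2 (q z / joint z) + log 2 T))"
  proof (rule sum_mono)
    fix z
    show "joint z * (\<Sum>i\<in>UNIV. log 2 (g i (h i z))) \<le> joint z * (log 2 (q z / joint z) + log 2 T)"
      using pos[of z] joint_nonneg[of z] by (cases "joint z = 0") (auto intro: mult_left_mono)
  qed
  also have "\<dots> \<le> log 2 T"
    using G sum_joint by (simp add: distrib_left sum.distrib flip: sum_distrib_right)
  finally show ?thesis by (simp add: g_def)
qed

end

section \<open>The channel induced on a single letter\<close>

context product_source
begin

text \<open>The channel from input letter \<open>i\<close> to output letter \<open>i\<close> when
  the other inputs are drawn independently from the C-marginal of the source.\<close>

definition chan :: "'n \<Rightarrow> 'c \<Rightarrow> 'b \<Rightarrow> real" where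
  "chan i c b = (\<Sum>cs\<in>UNIV. \<Sum>bs\<in>UNIV.
     if cs i = c \<and> bs i = b then (\<Prod>j\<in>UNIV - {i}. marg snd r (cs j)) * \<kappa> cs bs else 0)"

definition letter_out :: "'n \<Rightarrow> 'x \<times> 'b \<Rightarrow> real" where
  "letter_out i = (\<lambda>(x, b). \<Sum>c\<in>UNIV. letter i (x, c, b))"

text \<open>Since \<open>\<kappa>\<close> does not see \<open>xs\<close>, summing out the other X
  letters turns their factors into marginals; what multiplies \<open>r (x, c)\<close> then depends
  on \<open>c\<close> and \<open>b\<close> only.\<close>

lemma letter_eq: "letter i (x, c, b) = r (x, c) * chan i c b"
proof -
  have inner: "(\<Sum>xs\<in>UNIV. if xs i = x then \<Prod>j\<in>UNIV. r (xs j, cs j) else 0)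
      = r (x, cs i) * (\<Prod>j\<in>UNIV - {i}. marg snd r (cs j))" for cs :: "'n \<Rightarrow> 'c"
  proof -
    \<comment> \<open>The constraint on coordinate \<open>i\<close> is absorbed into factor
      \<open>i\<close>, so the constrained sum of products is again a product of sums.\<close>
    define f where "f j y = (if j = i then (if y = x then r (y, cs j) else 0) else r (y, cs j))" for j y
    have "(\<Sum>xs\<in>UNIV. if xs i = x then \<Prod>j\<in>UNIV. r (xs j, cs j) else 0) = (\<Sum>xs\<in>UNIV. \<Prod>j\<in>UNIV. f j (xs j))"
    proof (rule sum.cong[OF refl])
      fix xs :: "'n \<Rightarrow> 'x"
      have "(\<Prod>j\<in>UNIV. f j (xs j)) = f i (xs i) * (\<Prod>j\<in>UNIV - {i}. f j (xs j))"
        by (rule prod.remove) auto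
      also have "(\<Prod>j\<in>UNIV - {i}. f j (xs j)) = (\<Prod>j\<in>UNIV - {i}. r (xs j, cs j))"
        by (rule prod.cong) (auto simp: f_def)
      finally show "(if xs i = x then \<Prod>j\<in>UNIV. r (xs j, cs j) else 0) = (\<Prod>j\<in>UNIV. f j (xs j))"
        using prod.remove[of UNIV i "\<lambda>j. r (xs j, cs j)"] by (simp add: f_def)
    qed
    also have "\<dots> = (\<Prod>j\<in>UNIV. \<Sum>y\<in>UNIV. f j y)" by (rule prod_sum_UNIV)
    also have "\<dots> = (\<Sum>y\<in>UNIV. f i y) * (\<Prod>j\<in>UNIV - {i}. \<Sum>y\<in>UNIV. f j y)"
      by (rule prod.remove) auto
    also have "(\<Prod>j\<in>UNIV - {i}. \<Sum>y\<in>UNIV. f j y) = (\<Prod>j\<in>UNIV - {i}. marg snd r (cs j))"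
      by (rule prod.cong) (auto simp: f_def marg_snd)
    finally show ?thesis by (simp add: f_def)
  qed
  have "letter i (x, c, b) = (\<Sum>z\<in>UNIV. if (case z of (xs, cs, bs) \<Rightarrow> (xs i, cs i, bs i)) = (x, c, b) then joint z else 0)"
    unfolding letter_def marg_def by (rule sum.mono_neutral_cong_left) auto
  also have "\<dots> = (\<Sum>xs\<in>UNIV. \<Sum>cs\<in>UNIV. \<Sum>bs\<in>UNIV. if cs i = c \<and> bs i = b then
      (if xs i = x then \<Prod>j\<in>UNIV. r (xs j, cs j) else 0) * \<kappa> cs bs else 0)"
    unfolding sum_UNIV_prod by (intro sum.cong refl) (simp add: joint_def)
  also have "\<dots> = (\<Sum>cs\<in>UNIV. \<Sum>xs\<in>UNIV. \<Sum>bs\<in>UNIV. if cs i = c \<and> bs i = b then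
      (if xs i = x then \<Prod>j\<in>UNIV. r (xs j, cs j) else 0) * \<kappa> cs bs else 0)"
    by (rule sum.swap)
  also have "\<dots> = (\<Sum>cs\<in>UNIV. \<Sum>bs\<in>UNIV. \<Sum>xs\<in>UNIV. if cs i = c \<and> bs i = b then
      (if xs i = x then \<Prod>j\<in>UNIV. r (xs j, cs j) else 0) * \<kappa> cs bs else 0)"
    by (rule sum.cong[OF refl], rule sum.swap)
  also have "\<dots> = (\<Sum>cs\<in>UNIV. \<Sum>bs\<in>UNIV. if cs i = c \<and> bs i = b then
      (\<Sum>xs\<in>UNIV. if xs i = x then \<Prod>j\<in>UNIV. r (xs j, cs j) else 0) * \<kappa> cs bs else 0)"
    by (intro sum.cong refl) (auto simp: sum_distrib_right intro!: sum.neutral)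
  also have "\<dots> = r (x, c) * chan i c b"
    unfolding inner chan_def sum_distrib_left by (intro sum.cong refl) auto
  finally show ?thesis .
qed

lemma chan_nonneg: "0 \<le> chan i c b"
  unfolding chan_def using r \<kappa>
  by (intro sum_nonneg) (auto intro!: mult_nonneg_nonneg prod_nonneg marg_nonneg)

lemma chan_sum: "(\<Sum>b\<in>UNIV. chan i c b) = 1"
proof -
  define f where "f j y = (if j = i then (if y = c then 1 else 0) else marg snd r y)" for j y
  have "(\<Sum>b\<in>UNIV. chan i c b) = (\<Sum>cs\<in>UNIV. \<Sum>b\<in>UNIV. \<Sum>bs\<in>UNIV.
     if cs i = c \<and> bs i = b then (\<Prod>j\<in>UNIV - {i}. marg snd r (cs j)) * \<kappa> cs bs else 0)"
    unfolding chan_def by (rule sum.swap)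
  also have "\<dots> = (\<Sum>cs\<in>UNIV. \<Sum>bs\<in>UNIV. \<Sum>b\<in>UNIV.
     if cs i = c \<and> bs i = b then (\<Prod>j\<in>UNIV - {i}. marg snd r (cs j)) * \<kappa> cs bs else 0)"
    by (rule sum.cong[OF refl], rule sum.swap)
  also have "\<dots> = (\<Sum>cs\<in>UNIV. \<Sum>bs\<in>UNIV. (\<Prod>j\<in>UNIV. f j (cs j)) * \<kappa> cs bs)"
  proof (intro sum.cong refl)
    fix cs bs
    have "(\<Prod>j\<in>UNIV. f j (cs j)) = f i (cs i) * (\<Prod>j\<in>UNIV - {i}. f j (cs j))"
      by (rule prod.remove) auto
    also have "(\<Prod>j\<in>UNIV - {i}. f j (cs j)) = (\<Prod>j\<in>UNIV - {i}. marg snd r (cs j))"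
      by (rule prod.cong) (auto simp: f_def)
    finally show "(\<Sum>b\<in>UNIV. if cs i = c \<and> bs i = b then (\<Prod>j\<in>UNIV - {i}. marg snd r (cs j)) * \<kappa> cs bs else 0)
        = (\<Prod>j\<in>UNIV. f j (cs j)) * \<kappa> cs bs"
      by (cases "cs i = c") (simp_all add: f_def)
  qed
  also have "\<dots> = (\<Sum>cs\<in>UNIV. \<Prod>j\<in>UNIV. f j (cs j))"
    by (simp add: \<kappa>1 flip: sum_distrib_left)
  also have "\<dots> = (\<Prod>j\<in>UNIV. \<Sum>y\<in>UNIV. f j y)" by (rule prod_sum_UNIV)
  also have "\<dots> = 1"
  proof (rule prod.neutral, intro ballI)
    fix j :: 'n
    have "sum (marg snd r) UNIV = 1" by (simp add: sum_marg_1 r1)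
    then show "(\<Sum>y\<in>UNIV. f j y) = 1" by (cases "j = i") (simp_all add: f_def)
  qed
  finally show ?thesis .
qed

lemma letter_in: "(\<Sum>b\<in>UNIV. letter i (x, c, b)) = r (x, c)"
  by (simp add: letter_eq chan_sum flip: sum_distrib_left)

lemma marg_letter_out: "marg snd (letter_out i) = out i"
  by (rule ext) (simp add: marg_snd letter_out_def out_eq)

lemma letter_out_nonneg: "0 \<le> letter_out i z"
  by (auto simp: letter_out_def letter_nonneg sum_nonneg split: prod.split)

lemma sum_letter_out: "sum (letter_out i) UNIV = 1"
proof -
  have "sum (letter_out i) UNIV = sum (out i) UNIV"
    using sum_marg_1[of snd "letter_out i"] by (simp add: marg_letter_out)
  also have "\<dots> = 1" by (simp add: out_def sum_marg_1 sum_letter)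
  finally show ?thesis .
qed

text \<open>This is I(XC:C') for one letter: the marginals of \<open>letter i\<close> are
  \<open>r\<close> on XC by \<open>letter_in\<close> and \<open>out i\<close> on C'. Where
  \<open>letter i\<close> is positive both are positive, so the logarithm splits.\<close>

lemma letter_info_eq:
  "(\<Sum>k\<in>UNIV. letter i k * log 2 (letter i k / (r (fst k, fst (snd k)) * out i (snd (snd k)))))
    = shannon r + shannon (out i) - shannon (letter i)"
proof -
  have "letter i k * log 2 (letter i k / (r (fst k, fst (snd k)) * out i (snd (snd k))))
    = letter i k * log 2 (letter i k) - letter i k * log 2 (r (fst k, fst (snd k)))
      - letter i k * log 2 (out i (snd (snd k)))" for k
  proof (cases "letter i k = 0")
    case False
    obtain x c b where k: "k = (x, c, b)" by (metis surj_pair)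
    have "r (x, c) \<noteq> 0" using False letter_eq[of i x c b] k by auto
    moreover have "out i b \<noteq> 0" using False letter_nonneg[of i k] letter_le_out[of i x c b] k by auto
    ultimately show ?thesis using False by (simp add: k log_divide log_mult algebra_simps)
  qed simp
  moreover have "(\<Sum>k\<in>UNIV. letter i k * log 2 (r (fst k, fst (snd k)))) = (\<Sum>z\<in>UNIV. r z * log 2 (r z))"
    by (simp add: sum_UNIV_prod letter_in flip: sum_distrib_right)
  moreover have "(\<Sum>k\<in>UNIV. letter i k * log 2 (out i (snd (snd k)))) = (\<Sum>b\<in>UNIV. out i b * log 2 (out i b))"
    using sum_marg[of "snd \<circ> snd" "letter i" "\<lambda>b. log 2 (out i b)"] by (simp add: out_def)
  ultimately show ?thesis by (simp add: shannon_def sum_subtractf)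
qed

end

text \<open>Each summand differs from I(XC:C') by H(X|C') under \<open>letter_out i\<close> minus
  H(X|C) under \<open>r\<close> minus the two correction terms, which is at most 0 by
  continuity.\<close>

lemma classical_converse:
  fixes r :: "'x::finite \<times> 'c::finite \<Rightarrow> real" and \<kappa> :: "('n::finite \<Rightarrow> 'c) \<Rightarrow> ('n \<Rightarrow> 'c) \<Rightarrow> real"
  assumes "product_source r \<kappa>"
    and K: "\<And>cs bs. \<kappa> cs bs \<le> K bs" "sum K UNIV = T"
    and err: "\<And>i. (\<Sum>z\<in>UNIV. \<bar>product_source.letter_out r \<kappa> i z - r z\<bar>) \<le> 2 * \<epsilon>"
  shows "(\<Sum>i\<in>UNIV. shannon (product_source.letter_out r \<kappa> i) + shannon (marg snd r)
       - shannon (product_source.letter r \<kappa> i) - \<epsilon> * log 2 CARD('x) - 1) \<le> log 2 T"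
proof -
  interpret product_source r \<kappa> by fact
  have "(\<Sum>i\<in>UNIV. shannon (letter_out i) + shannon (marg snd r) - shannon (letter i) - \<epsilon> * log 2 CARD('x) - 1)
      \<le> (\<Sum>i\<in>UNIV. shannon r + shannon (out i) - shannon (letter i))"
  proof (rule sum_mono)
    fix i
    show "shannon (letter_out i) + shannon (marg snd r) - shannon (letter i) - \<epsilon> * log 2 CARD('x) - 1
      \<le> shannon r + shannon (out i) - shannon (letter i)"
      using conditional_entropy_continuity[OF letter_out_nonneg r sum_letter_out r1 err[of i]]
      by (simp add: marg_letter_out)
  qed
  also have "\<dots> \<le> log 2 T"
    using sum_letter_info_le[OF K] by (simp add: letter_info_eq)
  finally show ?thesis .
qed

subsection \<open>Classical channels as feasible maps\<close>

text \<open>Measure in the computational basis, keep the outcome as first output and feed it to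
  \<open>V\<close>. The retained outcome is what preserves a diagonal state on XC.\<close>

definition diag_channel :: "('c \<Rightarrow> 'b \<Rightarrow> real) \<Rightarrow> ('c::finite) operator \<Rightarrow> ('c \<times> 'b::finite) operator" where
  "diag_channel V A = op_of (\<lambda>(c, b) (c', b'). if c = c' \<and> b = b' then A $ c $ c * of_real (V c b) else 0)"

lemma cptp_diag_channel:
  fixes V :: "'c::finite \<Rightarrow> 'b::finite \<Rightarrow> real"
  assumes V: "\<And>c b. 0 \<le> V c b" and V1: "\<And>c. (\<Sum>b\<in>UNIV. V c b) = 1"
  shows "cptp (diag_channel V)"
  unfolding cptp_def
proof (intro conjI allI)
  show "diag_channel V (A + B) = diag_channel V A + diag_channel V B" for A B
    by (rule operator_eqI) (auto simp: diag_channel_def distrib_right split: prod.split)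
  show "diag_channel V (map_matrix ((*) c) A) = map_matrix ((*) c) (diag_channel V A)" for c A
    by (rule operator_eqI) (auto simp: diag_channel_def split: prod.split)
  show "trace (diag_channel V A) = trace A" for A
    unfolding trace_def sum_UNIV_prod
    by (simp add: diag_channel_def V1 flip: sum_distrib_left of_real_sum)
  show "completely_positive (diag_channel V)"
    unfolding completely_positive_def block_psd_def Let_def
  proof (intro allI impI)
    fix k and A :: "nat \<Rightarrow> nat \<Rightarrow> 'c operator" and v :: "nat \<Rightarrow> complex^('c \<times> 'b)"
    let ?q = "\<lambda>v. \<Sum>i<k. \<Sum>j<k. \<Sum>r\<in>UNIV. \<Sum>s\<in>UNIV. cnj (v i $ r) * A i j $ r $ s * v j $ s"
    assume A: "\<forall>v. ?q v \<in> \<real> \<and> 0 \<le> Re (?q v)"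
    \<comment> \<open>The form of the output array splits over the output basis: the pair
      \<open>c\<close>, \<open>b\<close> contributes \<open>V c b\<close> times the form of the
      input array at \<open>w c b\<close>.\<close>
    define w where "w c b i = (\<chi> c'. if c' = c then v i $ (c, b) else 0)" for c b and i :: nat
    have q: "?q (w c b) \<in> \<real>\<^sub>\<ge>\<^sub>0" for c b
      using A[rule_format, of "w c b"] by (simp add: complex_nonneg_Reals_iff complex_is_Real_iff)
    have qw: "?q (w c b) = (\<Sum>i<k. \<Sum>j<k. cnj (v i $ (c, b)) * A i j $ c $ c * v j $ (c, b))" for c b
      by (simp add: w_def if_distrib[of cnj] if_distrib[of "\<lambda>x. x * _"] if_distrib[of "\<lambda>x. _ * x"]
           sum_if_const cong: if_cong)
    have "(\<Sum>i<k. \<Sum>j<k. \<Sum>r\<in>UNIV. \<Sum>s\<in>UNIV. cnj (v i $ r) * diag_channel V (A i j) $ r $ s * v j $ s)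
      = (\<Sum>i<k. \<Sum>j<k. \<Sum>z\<in>UNIV. of_real (V (fst z) (snd z)) * (cnj (v i $ z) * A i j $ fst z $ fst z * v j $ z))"
    proof (intro sum.cong refl)
      fix i j and z :: "'c \<times> 'b"
      have "diag_channel V (A i j) $ z $ s = (if s = z then A i j $ fst z $ fst z * of_real (V (fst z) (snd z)) else 0)" for s
        by (cases z; cases s) (auto simp: diag_channel_def)
      then show "(\<Sum>s\<in>UNIV. cnj (v i $ z) * diag_channel V (A i j) $ z $ s * v j $ s)
         = of_real (V (fst z) (snd z)) * (cnj (v i $ z) * A i j $ fst z $ fst z * v j $ z)"
        by (simp add: if_distrib[of "\<lambda>x. x * _"] if_distrib[of "\<lambda>x. _ * x"] cong: if_cong)
    qed
    also have "\<dots> = (\<Sum>i<k. \<Sum>z\<in>UNIV. \<Sum>j<k. of_real (V (fst z) (snd z)) * (cnj (v i $ z) * A i j $ fst z $ fst z * v j $ z))"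
      by (rule sum.cong[OF refl], rule sum.swap)
    also have "\<dots> = (\<Sum>z\<in>UNIV. \<Sum>i<k. \<Sum>j<k. of_real (V (fst z) (snd z)) * (cnj (v i $ z) * A i j $ fst z $ fst z * v j $ z))"
      by (rule sum.swap)
    also have "\<dots> = (\<Sum>z\<in>UNIV. of_real (V (fst z) (snd z)) * ?q (w (fst z) (snd z)))"
      by (simp add: qw sum_distrib_left)
    also have "\<dots> \<in> \<real>\<^sub>\<ge>\<^sub>0"
      using V by (intro nonneg_Reals_sum nonneg_Reals_mult_I[OF _ q]) auto
    finally show "(\<Sum>i<k. \<Sum>j<k. \<Sum>r\<in>UNIV. \<Sum>s\<in>UNIV. cnj (v i $ r) * diag_channel V (A i j) $ r $ s * v j $ s) \<in> \<real> \<and>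
      0 \<le> Re (\<Sum>i<k. \<Sum>j<k. \<Sum>r\<in>UNIV. \<Sum>s\<in>UNIV. cnj (v i $ r) * diag_channel V (A i j) $ r $ s * v j $ s)"
      by (simp add: complex_nonneg_Reals_iff complex_is_Real_iff)
  qed
qed

lemma id_tensor_diag_channel:
  "id_tensor (diag_channel V) (real_diag r) = real_diag (\<lambda>(x, c, b). r (x, c) * V c b)"
  by (rule operator_eqI) (auto simp: id_tensor_def diag_channel_def real_diag_nth split: prod.split)

lemma ptrace_snd_real_diag: "ptrace_snd (real_diag f) = real_diag (marg fst f)"
  by (rule operator_eqI) (simp add: ptrace_snd_def real_diag_nth marg_fst)

lemma ptrace_fst_real_diag: "ptrace_fst (real_diag f) = real_diag (marg snd f)"
  by (rule operator_eqI) (simp add: ptrace_fst_def real_diag_nth marg_snd)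

lemma rearrange_real_diag: "bij g \<Longrightarrow> rearrange g (real_diag f) = real_diag (f \<circ> g)"
  by (rule operator_eqI) (auto simp: rearrange_def real_diag_nth bij_def inj_def)

lemma shannon_bij: "bij g \<Longrightarrow> shannon (f \<circ> g) = shannon f"
  unfolding shannon_def using sum.reindex_bij_betw[of g UNIV UNIV "\<lambda>a. f a * log 2 (f a)"] by simp

lemma entropy_op_shannon: "entropy_op (real_diag f) = shannon f"
  by (simp add: entropy_op_real_diag shannon_def)

lemma mutual_info_real_diag:
  "mutual_info (real_diag f) = shannon (marg fst f) + shannon (marg snd f) - shannon f"
  by (simp add: mutual_info_def ptrace_snd_real_diag ptrace_fst_real_diag entropy_op_shannon)

text \<open>In I(C:C'X) - I(C:X) the entropy of C cancels, leaving H(XC') + H(XC) - H(XCC') -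
  H(X).\<close>

lemma diag_channel_feasible_cost:
  fixes r :: "'x::finite \<times> 'c::finite \<Rightarrow> real" and V :: "'c \<Rightarrow> 'c \<Rightarrow> real"
  assumes V: "\<And>c b. 0 \<le> V c b" and V1: "\<And>c. (\<Sum>b\<in>UNIV. V c b) = 1"
    and L: "\<And>x c b. L (x, c, b) = r (x, c) * V c b"
    and w: "\<And>x b. w (x, b) = (\<Sum>c\<in>UNIV. L (x, c, b))"
  shows "(\<Sum>z\<in>UNIV. \<bar>w z - r z\<bar>) \<le> 2 * \<epsilon> \<Longrightarrow> feasible_map (real_diag r) \<epsilon> (diag_channel V)" (is "_ \<Longrightarrow> ?feasible")
    and "map_cost (real_diag r) (diag_channel V) = shannon w + shannon r - shannon L - shannon (marg fst r)"
proof -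
  have L': "id_tensor (diag_channel V) (real_diag r) = real_diag L"
    unfolding id_tensor_diag_channel by (rule arg_cong[of _ _ real_diag]) (auto simp: L)
  have b1: "bij (\<lambda>((x::'x, c'::'c), c::'c). (x, c, c'))"
    by (rule o_bij[of "\<lambda>(x, c, c'). ((x, c'), c)"]) auto
  have b2: "bij (\<lambda>((x::'x, c::'c), c'::'c). (x, c, c'))"
    by (rule o_bij[of "\<lambda>(x, c, c'). ((x, c), c')"]) auto
  have in_r: "(\<Sum>b\<in>UNIV. L (x, c, b)) = r (x, c)" for x c
    by (simp add: L V1 flip: sum_distrib_left)
  have 1: "ptrace_snd (rearrange (\<lambda>((x, c'), c). (x, c, c')) (real_diag L)) = real_diag w"
    unfolding rearrange_real_diag[OF b1] ptrace_snd_real_diag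
    by (rule arg_cong[of _ _ real_diag]) (auto simp: marg_fst w)
  have 2: "ptrace_snd (rearrange (\<lambda>((x, c), c'). (x, c, c')) (real_diag L)) = real_diag r"
    unfolding rearrange_real_diag[OF b2] ptrace_snd_real_diag
    by (rule arg_cong[of _ _ real_diag]) (auto simp: marg_fst in_r)
  have 3: "real_diag w - real_diag r = real_diag (\<lambda>z. w z - r z)"
    by (rule operator_eqI) (simp add: real_diag_nth)
  show ?feasible if "(\<Sum>z\<in>UNIV. \<bar>w z - r z\<bar>) \<le> 2 * \<epsilon>"
    unfolding feasible_map_def L' 1 2 trace_dist_def 3 trace_norm_real_diag
    using that cptp_diag_channel[OF V V1] by simp
  \<comment> \<open>\<open>g\<close> is \<open>L\<close> in the register order C, C', X of the
    cost.\<close>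
  define g where "g = L \<circ> (\<lambda>(c, c', x). (x, c, c'))"
  have gL: "shannon g = shannon L" unfolding g_def by (rule shannon_bij[OF bij_rotate])
  have g1: "marg fst g = marg snd r"
  proof
    fix c
    have "marg fst g c = (\<Sum>c'\<in>UNIV. \<Sum>x\<in>UNIV. L (x, c, c'))" by (simp add: marg_fst g_def sum_UNIV_prod)
    also have "\<dots> = (\<Sum>x\<in>UNIV. \<Sum>c'\<in>UNIV. L (x, c, c'))" by (rule sum.swap)
    finally show "marg fst g c = marg snd r c" by (simp add: in_r marg_snd)
  qed
  have g2: "marg snd g = w \<circ> prod.swap"
    by (rule ext) (auto simp: marg_snd g_def w)
  have g3: "marg fst (g \<circ> (\<lambda>((a, c), b). (a, b, c))) = r \<circ> prod.swap"
    by (rule ext) (auto simp: marg_fst g_def in_r)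
  have g4: "marg fst (r \<circ> prod.swap) = marg snd r" "marg snd (r \<circ> prod.swap) = marg fst r"
    by (auto simp: marg_fst marg_snd)
  show "map_cost (real_diag r) (diag_channel V) = shannon w + shannon r - shannon L - shannon (marg fst r)"
    unfolding map_cost_def L' cond_mutual_info_def rearrange_real_diag[OF bij_rotate]
      rearrange_real_diag[OF bij_regroup] ptrace_snd_real_diag mutual_info_real_diag
      g_def[symmetric] g3 g4 g1 g2 gL
    by (simp add: shannon_bij)
qed

subsection \<open>Reduction of protocols to classical channels\<close>

lemma psd_pure: "psd (op_of (\<lambda>i j. \<psi> i * cnj (\<psi> j)))"
  unfolding psd_iff
proof
  fix v
  have "qform (op_of (\<lambda>i j. \<psi> i * cnj (\<psi> j))) v
     = cnj (\<Sum>i\<in>UNIV. cnj (\<psi> i) * v $ i) * (\<Sum>j\<in>UNIV. cnj (\<psi> j) * v $ j)"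
    unfolding qform_def cnj_sum sum_product by (simp add: mult_ac)
  then show "qform (op_of (\<lambda>i j. \<psi> i * cnj (\<psi> j))) v \<in> \<real>\<^sub>\<ge>\<^sub>0"
    by (simp only: nonneg_Reals_cnj_mult)
qed

lemma psd_real_diag:
  assumes "\<And>z. 0 \<le> r z"
  shows "psd (real_diag r)"
  unfolding psd_iff
proof
  fix v
  have "qform (real_diag r) v = (\<Sum>i\<in>UNIV. of_real (r i) * (cnj (v $ i) * v $ i))"
    by (simp add: qform_def real_diag_nth if_distrib[of "\<lambda>x. x * _"] if_distrib[of "\<lambda>x. _ * x"] mult_ac cong: if_cong)
  also have "\<dots> \<in> \<real>\<^sub>\<ge>\<^sub>0"
    using assms by (intro nonneg_Reals_sum nonneg_Reals_mult_I nonneg_Reals_cnj_mult) auto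
  finally show "qform (real_diag r) v \<in> \<real>\<^sub>\<ge>\<^sub>0" .
qed

lemma cptp_zero: "cptp F \<Longrightarrow> F 0 = 0"
  using cptp_add[of F 0 0] by simp

lemma cptp_sum: "cptp F \<Longrightarrow> F (\<Sum>k\<in>S. A k) = (\<Sum>k\<in>S. F (A k))"
  by (induction S rule: infinite_finite_induct) (auto simp: cptp_zero cptp_add)

text \<open>
  The state of \<open>TE\<^sub>B\<close> after the encoding of the basis state \<open>c\<close>, with Alice's output register traced out.
\<close>

definition bob_state ::
  "complex^('ea::finite \<times> 'eb::finite) \<Rightarrow> (('k::finite \<times> 'ea) operator \<Rightarrow> ('l::finite \<times> 't::finite) operator)
    \<Rightarrow> 'k \<Rightarrow> ('t \<times> 'eb) operator" where
  "bob_state \<theta> E c = ptrace_snd (rearrange (\<lambda>((t, b), l). (b, (l, t)))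
     (id_tensor E (op_of (\<lambda>(b, c1, a) (b', c2, a').
       (if c1 = c then \<theta> $ (a, b) else 0) * cnj (if c2 = c then \<theta> $ (a', b') else 0)))))"

text \<open>The block between \<open>b\<close> and \<open>b'\<close> on the register of Bob of the
  pure state formed by basis state \<open>c\<close> and \<open>\<theta>\<close>; this is the
  argument that \<open>id_tensor E\<close> passes to \<open>E\<close>.\<close>

definition basis_block :: "complex^('ea::finite \<times> 'eb::finite) \<Rightarrow> 'k::finite \<Rightarrow> 'eb \<Rightarrow> 'eb \<Rightarrow> ('k \<times> 'ea) operator" where
  "basis_block \<theta> c b b' = op_of (\<lambda>(c1, a) (c2, a').
     if c1 = c \<and> c2 = c then \<theta> $ (a, b) * cnj (\<theta> $ (a', b')) else 0)"

lemma bob_state_nth: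
  "bob_state \<theta> E c $ (t, b) $ (t', b') = (\<Sum>l\<in>UNIV. E (basis_block \<theta> c b b') $ (l, t) $ (l, t'))"
proof -
  have "op_of (\<lambda>a a'. op_of (\<lambda>(b, c1, a) (b', c2, a').
       (if c1 = c then \<theta> $ (a, b) else 0) * cnj (if c2 = c then \<theta> $ (a', b') else 0)) $ (b, a) $ (b', a'))
     = basis_block \<theta> c b b'"
    by (rule operator_eqI) (auto simp: basis_block_def split: prod.split)
  then show ?thesis
    by (simp add: bob_state_def ptrace_snd_def rearrange_def id_tensor_def)
qed

lemma psd_bob_state:
  assumes "cptp E"
  shows "psd (bob_state \<theta> E c)"
proof -
  let ?\<psi> = "\<lambda>(b, c1, a). if c1 = c then \<theta> $ (a, b) else 0"
  have "op_of (\<lambda>(b, c1, a) (b', c2, a').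
       (if c1 = c then \<theta> $ (a, b) else 0) * cnj (if c2 = c then \<theta> $ (a', b') else 0))
     = op_of (\<lambda>i j. ?\<psi> i * cnj (?\<psi> j))"
    by (rule arg_cong[of _ _ op_of]) (auto simp: fun_eq_iff)
  moreover have "bij (\<lambda>((t, b), l). (b, (l, t)))"
    by (rule o_bij[of "\<lambda>(b, (l, t)). ((t, b), l)"]) auto
  ultimately show ?thesis
    unfolding bob_state_def using assms
    by (simp only:) (intro psd_ptrace_snd psd_rearrange psd_id_tensor psd_pure; simp add: cptp_def)
qed

lemma bob_state_off: "classical_snd E \<Longrightarrow> t \<noteq> t' \<Longrightarrow> bob_state \<theta> E c $ (t, b) $ (t', b') = 0"
  by (simp add: bob_state_nth classical_snd_def)

text \<open>Tracing out both outputs of \<open>E\<close> leaves only the trace of each block, which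
  \<open>E\<close> preserves; hence the right side is free of \<open>c\<close>.\<close>

lemma bob_state_no_signalling:
  assumes "cptp E"
  shows "(\<Sum>t\<in>UNIV. bob_state \<theta> E c $ (t, b) $ (t, b')) = (\<Sum>a\<in>UNIV. \<theta> $ (a, b) * cnj (\<theta> $ (a, b')))"
proof -
  have "(\<Sum>t\<in>UNIV. bob_state \<theta> E c $ (t, b) $ (t, b')) = trace (E (basis_block \<theta> c b b'))"
    unfolding bob_state_nth trace_def sum_UNIV_prod by (rule sum.swap)
  also have "\<dots> = trace (basis_block \<theta> c b b')" using assms by (rule cptp_trace)
  also have "\<dots> = (\<Sum>a\<in>UNIV. \<theta> $ (a, b) * cnj (\<theta> $ (a, b')))"
    by (simp add: trace_def sum_UNIV_prod basis_block_def sum_if_const)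
  finally show ?thesis .
qed

text \<open>The operator \<open>1\<^sub>T \<otimes> \<theta>\<^sub>B\<close>.\<close>

definition message_bound :: "complex^('ea::finite \<times> 'eb::finite) \<Rightarrow> ('t::finite \<times> 'eb) operator" where
  "message_bound \<theta> = op_of (\<lambda>(t, b) (t', b'). if t = t' then \<Sum>a\<in>UNIV. \<theta> $ (a, b) * cnj (\<theta> $ (a, b')) else 0)"

lemma norm_vec_one: "norm \<theta> = 1 \<Longrightarrow> (\<Sum>z\<in>UNIV. \<theta> $ z * cnj (\<theta> $ z)) = 1" for \<theta> :: "complex^'z::finite"
proof -
  assume "norm \<theta> = 1"
  then have "(\<Sum>z\<in>UNIV. (cmod (\<theta> $ z))\<^sup>2) = 1" by (simp add: norm_vec_def L2_set_def)
  then have "(\<Sum>z\<in>UNIV. complex_of_real ((cmod (\<theta> $ z))\<^sup>2)) = 1" by (metis of_real_1 of_real_sum)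
  then show ?thesis by (simp only: complex_norm_square)
qed

lemma sum_theta:
  assumes "norm (\<theta> :: complex^('ea::finite \<times> 'eb::finite)) = 1"
  shows "(\<Sum>b\<in>UNIV. \<Sum>a\<in>UNIV. \<theta> $ (a, b) * cnj (\<theta> $ (a, b))) = 1"
  using norm_vec_one[OF assms] by (subst sum.swap) (simp add: sum_UNIV_prod)

lemma trace_bob_state:
  assumes "cptp E" "norm \<theta> = 1"
  shows "trace (bob_state \<theta> E c) = 1"
proof -
  have "trace (bob_state \<theta> E c) = (\<Sum>b\<in>UNIV. \<Sum>t\<in>UNIV. bob_state \<theta> E c $ (t, b) $ (t, b))"
    unfolding trace_def sum_UNIV_prod by (rule sum.swap)
  then show ?thesis by (simp add: bob_state_no_signalling assms sum_theta)
qed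

lemma trace_message_bound:
  assumes "norm \<theta> = 1"
  shows "trace (message_bound \<theta> :: ('t::finite \<times> 'eb::finite) operator) = of_nat CARD('t)"
  unfolding trace_def sum_UNIV_prod by (simp add: message_bound_def sum_theta assms)

text \<open>Since the message is classical, the \<open>t\<close>-block of the difference is the sum of the
  other blocks of Bob's state.\<close>

lemma psd_message_bound_diff:
  fixes E :: "('k::finite \<times> 'ea::finite) operator \<Rightarrow> ('l::finite \<times> 't::finite) operator"
    and \<theta> :: "complex^('ea \<times> 'eb::finite)"
  assumes E: "cptp E" "classical_snd E"
  shows "psd (message_bound \<theta> - bob_state \<theta> E c)"
  unfolding psd_iff
proof
  fix v :: "complex^('t \<times> 'eb)"
  \<comment> \<open>\<open>u t s\<close> moves the \<open>t\<close>-block of \<open>v\<close> to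
    position \<open>s\<close>, where it tests the \<open>s\<close>-block of Bob's state.\<close>
  define u where "u t s = (\<chi> z. if fst z = s then v $ (t, snd z) else 0)" for t s :: 't
  have q: "qform (bob_state \<theta> E c) (u t s)
     = (\<Sum>b\<in>UNIV. \<Sum>b'\<in>UNIV. cnj (v $ (t, b)) * bob_state \<theta> E c $ (s, b) $ (s, b') * v $ (t, b'))" for t s
    by (simp add: qform_def u_def sum_UNIV_prod if_distrib[of cnj] if_distrib[of "\<lambda>x. x * _"]
          if_distrib[of "\<lambda>x. _ * x"] sum_if_const cong: if_cong)
  have nth: "(message_bound \<theta> - bob_state \<theta> E c) $ (t, b) $ (t', b')
     = (if t = t' then \<Sum>s\<in>UNIV - {t}. bob_state \<theta> E c $ (s, b) $ (s, b') else 0)" for t b t' b'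
  proof (cases "t = t'")
    case True
    have "(\<Sum>s\<in>UNIV. bob_state \<theta> E c $ (s, b) $ (s, b')) = bob_state \<theta> E c $ (t, b) $ (t, b')
        + (\<Sum>s\<in>UNIV - {t}. bob_state \<theta> E c $ (s, b) $ (s, b'))"
      by (rule sum.remove) auto
    then show ?thesis using True by (simp add: message_bound_def bob_state_no_signalling[OF E(1)])
  qed (simp add: message_bound_def bob_state_off[OF E(2)])
  have "qform (message_bound \<theta> - bob_state \<theta> E c) v
     = (\<Sum>t\<in>UNIV. \<Sum>b\<in>UNIV. \<Sum>b'\<in>UNIV. \<Sum>s\<in>UNIV - {t}.
          cnj (v $ (t, b)) * bob_state \<theta> E c $ (s, b) $ (s, b') * v $ (t, b'))"
  proof -
    have "(\<Sum>t'\<in>UNIV. \<Sum>b'\<in>UNIV. cnj (v $ (t, b)) * (message_bound \<theta> - bob_state \<theta> E c) $ (t, b) $ (t', b') * v $ (t', b'))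
       = (\<Sum>b'\<in>UNIV. \<Sum>s\<in>UNIV - {t}. cnj (v $ (t, b)) * bob_state \<theta> E c $ (s, b) $ (s, b') * v $ (t, b'))" for t b
      unfolding nth by (simp add: if_distrib[of "\<lambda>x. x * _"] if_distrib[of "\<lambda>x. _ * x"] sum_if_const
          sum_distrib_left sum_distrib_right cong: if_cong)
    then show ?thesis unfolding qform_def sum_UNIV_prod by simp
  qed
  also have "\<dots> = (\<Sum>t\<in>UNIV. \<Sum>b\<in>UNIV. \<Sum>s\<in>UNIV - {t}. \<Sum>b'\<in>UNIV.
          cnj (v $ (t, b)) * bob_state \<theta> E c $ (s, b) $ (s, b') * v $ (t, b'))"
    by (rule sum.cong[OF refl], rule sum.cong[OF refl], rule sum.swap)
  also have "\<dots> = (\<Sum>t\<in>UNIV. \<Sum>s\<in>UNIV - {t}. qform (bob_state \<theta> E c) (u t s))"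
    unfolding q by (rule sum.cong[OF refl], rule sum.swap)
  also have "\<dots> \<in> \<real>\<^sub>\<ge>\<^sub>0"
    using psd_bob_state[OF E(1)] unfolding psd_iff by (intro nonneg_Reals_sum) blast
  finally show "qform (message_bound \<theta> - bob_state \<theta> E c) v \<in> \<real>\<^sub>\<ge>\<^sub>0" .
qed

definition measured_channel ::
  "complex^('ea::finite \<times> 'eb::finite) \<Rightarrow> (('k::finite \<times> 'ea) operator \<Rightarrow> ('l::finite \<times> 't::finite) operator)
    \<Rightarrow> (('t \<times> 'eb) operator \<Rightarrow> ('m::finite) operator) \<Rightarrow> 'k \<Rightarrow> 'm \<Rightarrow> real" where
  "measured_channel \<theta> E D c m = Re (D (bob_state \<theta> E c) $ m $ m)"

lemma measured_channel_nonneg: "cptp E \<Longrightarrow> cptp D \<Longrightarrow> 0 \<le> measured_channel \<theta> E D c m"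
  using psd_diag[OF psd_cptp[OF _ psd_bob_state], of D E \<theta> c m]
  by (simp add: measured_channel_def complex_nonneg_Reals_iff)

lemma of_real_measured_channel:
  "cptp E \<Longrightarrow> cptp D \<Longrightarrow> D (bob_state \<theta> E c) $ m $ m = of_real (measured_channel \<theta> E D c m)"
  using psd_diag[OF psd_cptp[OF _ psd_bob_state], of D E \<theta> c m]
  by (simp add: measured_channel_def complex_nonneg_Reals_iff complex_eq_iff)

lemma sum_measured_channel:
  assumes "cptp E" "cptp D" "norm \<theta> = 1"
  shows "(\<Sum>m\<in>UNIV. measured_channel \<theta> E D c m) = 1"
proof -
  have "(\<Sum>m\<in>UNIV. measured_channel \<theta> E D c m) = Re (trace (D (bob_state \<theta> E c)))"
    by (simp add: measured_channel_def trace_def)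
  then show ?thesis by (simp add: cptp_trace[OF assms(2)] trace_bob_state assms)
qed

text \<open>\<open>D\<close> keeps the operator difference positive, so its diagonal entries are
  nonnegative. The right side does not depend on \<open>c\<close> and sums to |T| by
  \<open>sum_message_bound\<close>.\<close>

lemma measured_channel_le:
  assumes "cptp E" "classical_snd E" "cptp D"
  shows "measured_channel \<theta> E D c m \<le> Re (D (message_bound \<theta>) $ m $ m)"
proof -
  have "D (message_bound \<theta>) = D (bob_state \<theta> E c) + D (message_bound \<theta> - bob_state \<theta> E c)"
    by (simp flip: cptp_add[OF assms(3)])
  moreover have "0 \<le> Re (D (message_bound \<theta> - bob_state \<theta> E c) $ m $ m)"
    using psd_diag[OF psd_cptp[OF assms(3) psd_message_bound_diff[OF assms(1,2)]], of \<theta> c m]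
    by (simp add: complex_nonneg_Reals_iff)
  ultimately show ?thesis by (simp add: measured_channel_def)
qed

lemma sum_message_bound:
  assumes "cptp D" "norm \<theta> = 1"
  shows "(\<Sum>m\<in>UNIV. Re ((D :: ('t::finite \<times> 'eb::finite) operator \<Rightarrow> _) (message_bound \<theta>) $ m $ m)) = real CARD('t)"
proof -
  have "(\<Sum>m\<in>UNIV. Re (D (message_bound \<theta>) $ m $ m)) = Re (trace (D (message_bound \<theta>)))"
    by (simp add: trace_def)
  then show ?thesis by (simp add: cptp_trace[OF assms(1)] trace_message_bound assms)
qed

lemma copies_real_diag:
  fixes r :: "'x::finite \<times> 'c::finite \<Rightarrow> real"
  shows "copies (real_diag r) = real_diag (\<lambda>(xs, cs). \<Prod>j\<in>UNIV. r (xs j, cs j))"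
proof (rule operator_eqI)
  fix z z' :: "('n::finite \<Rightarrow> 'x) \<times> ('n \<Rightarrow> 'c)"
  obtain xs cs xs' cs' where z: "z = (xs, cs)" "z' = (xs', cs')" by (metis surj_pair)
  show "copies (real_diag r) $ z $ z' = real_diag (\<lambda>(xs, cs). \<Prod>j\<in>UNIV. r (xs j, cs j)) $ z $ z'"
  proof (cases "z = z'")
    case False
    then obtain j where "(xs j, cs j) \<noteq> (xs' j, cs' j)" using z by auto
    then have "(\<Prod>j\<in>UNIV. real_diag r $ (xs j, cs j) $ (xs' j, cs' j)) = 0"
      by (intro prod_zero bexI[of _ j]) (auto simp: real_diag_nth)
    then show ?thesis using False by (simp add: copies_def z real_diag_nth)
  qed (simp add: copies_def z real_diag_nth)
qed

text \<open>A diagonal source is a mixture of basis states, so linearity of \<open>E\<close> and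
  \<open>D\<close> turns Bob's output into the same mixture of measured channels.\<close>

lemma output_state_diag:
  fixes E :: "(('n::finite \<Rightarrow> 'c::finite) \<times> 'ea::finite) operator \<Rightarrow> (('n \<Rightarrow> 'c) \<times> 't::finite) operator"
    and D :: "('t \<times> 'eb::finite) operator \<Rightarrow> ('n \<Rightarrow> 'c) operator"
    and r :: "'x::finite \<times> 'c \<Rightarrow> real" and \<theta> :: "complex^('ea \<times> 'eb)"
  assumes E: "cptp E" and D: "cptp D"
  shows "output_state (real_diag r) \<theta> E D $ (xs, bs) $ (xs, bs) =
     of_real (\<Sum>cs\<in>UNIV. (\<Prod>j\<in>UNIV. r (xs j, cs j)) * measured_channel \<theta> E D cs bs)"
proof -
  define P where "P cs = (\<Prod>j\<in>UNIV. r (xs j, cs j))" for cs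
  \<comment> \<open>Here \<open>cs\<close> labels the register returned by the encoder, which is
    traced out, whereas \<open>c\<close> in the sums below labels the input.\<close>
  define X where "X cs = op_of (\<lambda>y y'. encoded_state (real_diag r) \<theta> E $ ((xs, cs), y) $ ((xs, cs), y'))" for cs
  have blk: "op_of (\<lambda>y y'. (initial_state (real_diag r) \<theta> :: ((('n \<Rightarrow> 'x) \<times> 'eb) \<times> (('n \<Rightarrow> 'c) \<times> 'ea)) operator) $ ((xs, b), y) $ ((xs, b'), y'))
     = (\<Sum>c\<in>UNIV. map_matrix ((*) (of_real (P c))) (basis_block \<theta> c b b'))" for b b'
    by (rule operator_eqI)
       (auto simp: initial_state_def copies_real_diag real_diag_nth P_def basis_block_def
          if_distrib[of "\<lambda>x. _ * x"] intro!: sum.neutral split: prod.split cong: if_cong)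
  have "(\<Sum>cs\<in>UNIV. X cs) = (\<Sum>c\<in>UNIV. map_matrix ((*) (of_real (P c))) (bob_state \<theta> E c))"
  proof (rule operator_eqI)
    fix y y' :: "'t \<times> 'eb"
    obtain t b t' b' where y: "y = (t, b)" "y' = (t', b')" by (metis surj_pair)
    have "(\<Sum>cs\<in>UNIV. X cs) $ y $ y' = (\<Sum>cs\<in>UNIV. \<Sum>c\<in>UNIV. of_real (P c) * E (basis_block \<theta> c b b') $ (cs, t) $ (cs, t'))"
      by (simp add: y X_def encoded_state_def rearrange_def id_tensor_def blk cptp_sum[OF E] cptp_scale[OF E])
    also have "\<dots> = (\<Sum>c\<in>UNIV. \<Sum>cs\<in>UNIV. of_real (P c) * E (basis_block \<theta> c b b') $ (cs, t) $ (cs, t'))"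
      by (rule sum.swap)
    also have "\<dots> = (\<Sum>c\<in>UNIV. map_matrix ((*) (of_real (P c))) (bob_state \<theta> E c)) $ y $ y'"
      by (simp add: y bob_state_nth sum_distrib_left)
    finally show "(\<Sum>cs\<in>UNIV. X cs) $ y $ y' = \<dots>" .
  qed
  moreover have "output_state (real_diag r) \<theta> E D $ (xs, bs) $ (xs, bs) = D (\<Sum>cs\<in>UNIV. X cs) $ bs $ bs"
    by (simp add: output_state_def ptrace_snd_def rearrange_def final_state_def id_tensor_def X_def cptp_sum[OF D])
  ultimately show ?thesis
    by (simp add: cptp_sum[OF D] cptp_scale[OF D] of_real_measured_channel[OF E D] P_def)
qed

section \<open>Letter marginals and transfer of the error criteria\<close>

lemma marg_mid: "marg (\<lambda>(x, c, b). (x, b)) f = (\<lambda>(x, b). \<Sum>c\<in>UNIV. f (x, c, b))"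
  for f :: "'x::finite \<times> 'c::finite \<times> 'b::finite \<Rightarrow> real"
proof
  fix z
  have "{k :: 'x \<times> 'c \<times> 'b. (case k of (x, c, b) \<Rightarrow> (x, b)) = z} = (\<lambda>c. (fst z, c, snd z)) ` UNIV" by auto
  then show "marg (\<lambda>(x, c, b). (x, b)) f z = (case z of (x, b) \<Rightarrow> \<Sum>c\<in>UNIV. f (x, c, b))"
    by (simp add: marg_def sum.reindex inj_on_def case_prod_beta)
qed

lemma marg_last: "marg (\<lambda>(x, c, b). (x, c)) f = (\<lambda>(x, c). \<Sum>b\<in>UNIV. f (x, c, b))"
  for f :: "'x::finite \<times> 'c::finite \<times> 'b::finite \<Rightarrow> real"
proof
  fix z
  have "{k :: 'x \<times> 'c \<times> 'b. (case k of (x, c, b) \<Rightarrow> (x, c)) = z} = (\<lambda>b. (fst z, snd z, b)) ` UNIV" by auto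
  then show "marg (\<lambda>(x, c, b). (x, c)) f z = (case z of (x, c) \<Rightarrow> \<Sum>b\<in>UNIV. f (x, c, b))"
    by (simp add: marg_def sum.reindex inj_on_def case_prod_beta)
qed

text \<open>Data processing for the l1 distance; it passes from the global error to a single
  letter.\<close>

lemma marg_contraction:
  fixes g :: "'z::finite \<Rightarrow> 'k::finite"
  shows "(\<Sum>k\<in>UNIV. \<bar>marg g F k - marg g G k\<bar>) \<le> (\<Sum>z\<in>UNIV. \<bar>F z - G z\<bar>)"
proof -
  have "(\<Sum>k\<in>UNIV. \<bar>marg g F k - marg g G k\<bar>) \<le> (\<Sum>k\<in>UNIV. marg g (\<lambda>z. \<bar>F z - G z\<bar>) k)"
    by (intro sum_mono) (simp add: marg_def sum_abs flip: sum_subtractf)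
  then show ?thesis by (simp add: sum_marg_1)
qed

context product_source
begin

definition out_joint :: "('n \<Rightarrow> 'x) \<times> ('n \<Rightarrow> 'b) \<Rightarrow> real" where
  "out_joint = (\<lambda>(xs, bs). \<Sum>cs\<in>UNIV. (\<Prod>j\<in>UNIV. r (xs j, cs j)) * \<kappa> cs bs)"

lemma letter_out_eq_marg: "letter_out i = marg (\<lambda>(xs, bs). (xs i, bs i)) out_joint"
proof -
  have "out_joint = marg (\<lambda>(xs, cs, bs). (xs, bs)) joint"
    by (simp add: marg_mid out_joint_def joint_def)
  then have "marg (\<lambda>(xs, bs). (xs i, bs i)) out_joint = marg (\<lambda>(xs, cs, bs). (xs i, bs i)) joint"
    by (simp add: marg_marg comp_def case_prod_unfold)
  moreover have "letter_out i = marg (\<lambda>(x, c, b). (x, b)) (letter i)"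
    by (simp add: marg_mid letter_out_def)
  then have "letter_out i = marg (\<lambda>(xs, cs, bs). (xs i, bs i)) joint"
    by (simp add: letter_def marg_marg comp_def case_prod_unfold)
  ultimately show ?thesis by simp
qed

text \<open>As \<open>\<kappa>\<close> sums to 1, the product source is itself a pushforward of
  \<open>joint\<close>, so its letters can be read off from \<open>letter i\<close>.\<close>

lemma source_letter: "marg (\<lambda>(xs, cs). (xs i, cs i)) (\<lambda>(xs, cs). \<Prod>j\<in>(UNIV :: 'n set). r (xs j, cs j)) = r"
proof -
  have "(\<lambda>(xs, cs). \<Prod>j\<in>(UNIV :: 'n set). r (xs j, cs j)) = marg (\<lambda>(xs, cs, bs). (xs, cs)) joint"
    by (simp add: marg_last joint_def \<kappa>1 flip: sum_distrib_left)
  then have "marg (\<lambda>(xs, cs). (xs i, cs i)) (\<lambda>(xs, cs). \<Prod>j\<in>(UNIV :: 'n set). r (xs j, cs j))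
     = marg (\<lambda>(xs, cs, bs). (xs i, cs i)) joint"
    by (simp add: marg_marg comp_def case_prod_unfold)
  also have "\<dots> = marg (\<lambda>(x, c, b). (x, c)) (letter i)"
    by (simp add: letter_def marg_marg comp_def case_prod_unfold)
  also have "\<dots> = r" by (auto simp: marg_last letter_in)
  finally show ?thesis .
qed

end

text \<open>Measuring in the computational basis does not increase the distance, so both error
  criteria pass to classical laws.\<close>

lemma sum_diag_le_trace_dist: "(\<Sum>z\<in>UNIV. cmod (A $ z $ z - B $ z $ z)) \<le> 2 * trace_dist A B"
  using sum_cmod_diag_le_trace_norm[of "A - B"] by (simp add: trace_dist_def)

lemma cq_state_real_diag:
  fixes p :: "'x::finite \<Rightarrow> real" and \<rho>C :: "'x \<Rightarrow> ('c::finite) operator"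
  assumes "ensemble p \<rho>C" and "\<And>x. diagonal_op (\<rho>C x)"
  defines "r \<equiv> (\<lambda>(x, c). p x * Re (\<rho>C x $ c $ c))"
  shows "cq_state p \<rho>C = real_diag r" and "\<And>z. 0 \<le> r z" and "sum r UNIV = 1"
proof -
  have d: "0 \<le> Re (\<rho>C x $ c $ c)" "Im (\<rho>C x $ c $ c) = 0" for x c
    using psd_diag[of "\<rho>C x" c] assms(1) by (auto simp: ensemble_def density_def complex_nonneg_Reals_iff)
  show "cq_state p \<rho>C = real_diag r"
  proof (rule operator_eqI)
    fix z z' :: "'x \<times> 'c"
    obtain x c x' c' where z: "z = (x, c)" "z' = (x', c')" by (metis surj_pair)
    show "cq_state p \<rho>C $ z $ z' = real_diag r $ z $ z'"
    proof (cases "c = c'")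
      case True
      then show ?thesis using d by (simp add: z cq_state_def real_diag_nth r_def complex_eq_iff)
    next
      case False
      then show ?thesis using assms(2) by (simp add: z cq_state_def real_diag_nth diagonal_op_def)
    qed
  qed
  show "0 \<le> r z" for z
    using assms(1) d by (auto simp: r_def ensemble_def split: prod.split)
  have "(\<Sum>c\<in>UNIV. Re (\<rho>C x $ c $ c)) = 1" for x
  proof -
    have "trace (\<rho>C x) = 1" using assms(1) by (simp add: ensemble_def density_def)
    then show ?thesis by (metis trace_def Re_sum one_complex.sel(1))
  qed
  then show "sum r UNIV = 1"
    using assms(1) by (simp add: sum_UNIV_prod r_def ensemble_def flip: sum_distrib_left)
qed

theorem theorem2:
  fixes p :: "'x::finite \<Rightarrow> real"
    and \<rho>C :: "'x \<Rightarrow> ('c::finite) operator"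
    and \<rho> :: "('x \<times> 'c) operator"
    and R \<epsilon> :: real
    and \<theta> :: "complex^('ea::finite \<times> 'eb::finite)"
    and E :: "(('n::finite \<Rightarrow> 'c) \<times> 'ea) operator \<Rightarrow> (('n \<Rightarrow> 'c) \<times> 't::finite) operator"
    and D :: "('t \<times> 'eb) operator \<Rightarrow> ('n \<Rightarrow> 'c) operator"
  assumes "ensemble p \<rho>C"
    and "\<And>x. diagonal_op (\<rho>C x)"
    and "\<rho> = cq_state p \<rho>C"
    and "0 < \<epsilon>" and "\<epsilon> < 1"
    and "ea_blind_protocol \<rho> R \<theta> E D"
    and "global_error_le \<rho> \<epsilon> \<theta> E D \<or> local_error_le \<rho> \<epsilon> \<theta> E D"
  shows "\<exists>F. is_arg_min (map_cost \<rho>) (feasible_map \<rho> \<epsilon>) F \<and>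
             R \<ge> map_cost \<rho> F + mutual_info \<rho> - \<epsilon> * log 2 (real CARD('x)) - 1"
proof -
  define r where "r = (\<lambda>(x, c). p x * Re (\<rho>C x $ c $ c))"
  note cq = cq_state_real_diag[OF assms(1,2), folded r_def]
  have \<rho>: "\<rho> = real_diag r" using assms(3) cq(1) by simp
  have E: "cptp E" "classical_snd E" and D: "cptp D" and \<theta>: "norm \<theta> = 1"
    and T: "real CARD('t) = 2 powr (real CARD('n) * R)"
    using assms(6) by (auto simp: ea_blind_protocol_def)
  define \<kappa> where "\<kappa> = measured_channel \<theta> E D"
  interpret product_source r \<kappa>
    using cq(2,3) measured_channel_nonneg[OF E(1) D] sum_measured_channel[OF E(1) D \<theta>]
    by unfold_locales (auto simp: \<kappa>_def)
  have out: "output_state \<rho> \<theta> E D $ z $ z = of_real (out_joint z)" for z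
    by (cases z) (simp only: \<rho> output_state_diag[OF E(1) D, where \<theta> = \<theta>, folded \<kappa>_def] out_joint_def prod.case)
  have err: "(\<Sum>z\<in>UNIV. \<bar>letter_out i z - r z\<bar>) \<le> 2 * \<epsilon>" for i
    using assms(7)
  proof
    assume "global_error_le \<rho> \<epsilon> \<theta> E D"
    then have "(\<Sum>z\<in>UNIV. cmod (output_state \<rho> \<theta> E D $ z $ z - copies \<rho> $ z $ z)) \<le> 2 * \<epsilon>"
      using sum_diag_le_trace_dist[of "output_state \<rho> \<theta> E D" "copies \<rho>"]
      unfolding global_error_le_def by linarith
    moreover have "cmod (output_state \<rho> \<theta> E D $ z $ z - copies \<rho> $ z $ z)
       = \<bar>out_joint z - (\<lambda>(xs, cs). \<Prod>j\<in>UNIV. r (xs j, cs j)) z\<bar>" for z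
      unfolding out unfolding \<rho> copies_real_diag real_diag_nth
      by (simp flip: of_real_diff del: of_real_prod add: case_prod_beta)
    ultimately show ?thesis
      using marg_contraction[of "\<lambda>(xs, cs). (xs i, cs i)" out_joint "\<lambda>(xs, cs). \<Prod>j\<in>UNIV. r (xs j, cs j)"]
      unfolding source_letter letter_out_eq_marg by simp
  next
    assume "local_error_le \<rho> \<epsilon> \<theta> E D"
    then have "trace_dist (copy_marginal i (output_state \<rho> \<theta> E D)) \<rho> \<le> \<epsilon>"
      unfolding local_error_le_def by blast
    then have "(\<Sum>z\<in>UNIV. cmod (copy_marginal i (output_state \<rho> \<theta> E D) $ z $ z - \<rho> $ z $ z)) \<le> 2 * \<epsilon>"
      using sum_diag_le_trace_dist[of "copy_marginal i (output_state \<rho> \<theta> E D)" \<rho>] by linarith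
    \<comment> \<open>On the diagonal the updates \<open>xs(i := x')\<close> and
      \<open>cs(i := c')\<close> restore the sequences themselves, so only diagonal entries of the
      output state are summed.\<close>
    moreover have "copy_marginal i (output_state \<rho> \<theta> E D) $ z $ z = of_real (letter_out i z)" for z
    proof -
      obtain x c where z: "z = (x, c)" by (cases z)
      have "copy_marginal i (output_state \<rho> \<theta> E D) $ z $ z
        = (\<Sum>y | (case y of (xs, bs) \<Rightarrow> (xs i, bs i)) = z. output_state \<rho> \<theta> E D $ y $ y)"
        by (auto simp: copy_marginal_def z case_prod_beta intro!: sum.cong)
      then show ?thesis unfolding out by (simp add: letter_out_eq_marg marg_def)
    qed
    ultimately show ?thesis by (simp add: \<rho> real_diag_nth flip: of_real_diff)
  qed
  have feas: "feasible_map \<rho> \<epsilon> (diag_channel (chan i))"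
    and cost: "map_cost \<rho> (diag_channel (chan i)) = shannon (letter_out i) + shannon r - shannon (letter i) - shannon (marg fst r)" for i
    unfolding \<rho>
    by (rule diag_channel_feasible_cost(1)[OF chan_nonneg chan_sum letter_eq _ err], simp add: letter_out_def)
       (rule diag_channel_feasible_cost(2)[OF chan_nonneg chan_sum letter_eq], simp add: letter_out_def)
  have "density \<rho>"
    unfolding density_def \<rho> using psd_real_diag[of r, OF cq(2)] cq(3)
    by (simp add: trace_def real_diag_nth flip: of_real_sum)
  then obtain F where F: "is_arg_min (map_cost \<rho>) (feasible_map \<rho> \<epsilon>) F"
    using feasible_arg_min_exists feas by blast
  have "real CARD('n) * (map_cost \<rho> F + mutual_info \<rho> - \<epsilon> * log 2 CARD('x) - 1)
     = (\<Sum>i\<in>(UNIV :: 'n set). map_cost \<rho> F + mutual_info \<rho> - \<epsilon> * log 2 CARD('x) - 1)"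
    by simp
  also have "\<dots> \<le> (\<Sum>i\<in>UNIV. shannon (letter_out i) + shannon (marg snd r)
       - shannon (letter i) - \<epsilon> * log 2 CARD('x) - 1)"
  proof (rule sum_mono)
    fix i
    \<comment> \<open>The minimum over all channels lies below the cost of the classical map of
      letter \<open>i\<close>; adding I(X:C) cancels the entropies of X and XC in that cost.\<close>
    have "map_cost \<rho> F \<le> map_cost \<rho> (diag_channel (chan i))"
      using F feas[of i] by (auto simp: is_arg_min_linorder)
    then show "map_cost \<rho> F + mutual_info \<rho> - \<epsilon> * log 2 CARD('x) - 1
       \<le> shannon (letter_out i) + shannon (marg snd r) - shannon (letter i) - \<epsilon> * log 2 CARD('x) - 1"
      unfolding cost by (simp add: \<rho> mutual_info_real_diag)
  qed
  also have "\<dots> \<le> log 2 (real CARD('t))"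
    by (rule classical_converse[OF product_source_axioms _ sum_message_bound[OF D \<theta>] err])
       (simp add: \<kappa>_def measured_channel_le[OF E D])
  also have "\<dots> = real CARD('n) * R" unfolding T by simp
  finally have "map_cost \<rho> F + mutual_info \<rho> - \<epsilon> * log 2 CARD('x) - 1 \<le> R"
    by simp
  then show ?thesis using F by blast
qed

end
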